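(* If $\mathcal M$ is a representable symmetric multicategory, then the category $\mathbf{cMon}(\mathcal M)$ of commutative monoids in $\mathcal M$, with the tensor product inherited from $\mathcal M$, is a cocartesian monoidal category (its unit is an initial object and its tensor product gives binary sums).
   Context: An arrow $u:A_1,\dots,A_n\to A$ in a symmetric multicategory $\mathcal M$ is preuniversal if composition with $u$ gives bijections $\mathcal M(A;B)\to\mathcal M(A_1,\dots,A_n;B)$ for all $B$; $\mathcal M$ is representable if every finite sequence of objects is the domain of a preuniversal arrow and preuniversal arrows are closed under composition (such preuniversal arrows are then called universal). Representable symmetric multicategories correspond to symmetric monoidal categories, universal arrows being $u:A,B\to A\otimes B$ and $u:\ \to I$ ($0$-ary). A commutative monoid on an object $A$ is given by compatible arrows $m_A^0:\ \to A$ ($0$-ary) and $m_A^2:A,A\to A$ satisfying unit, associativity and commutativity laws (equivalently, a symmetric functor from the terminal symmetric multicategory to $\mathcal M$). $\mathbf{cMon}(\mathcal M)$ is the category of commutative monoids and monoid morphisms. The tensor product of commutative monoids on $A$ and $B$ is the object $A\otimes B$, with universal $u:A,B\to A\otimes B$ in $\mathcal M$, and the monoid structure determined by $m^2_{A\otimes B}(u,u)=\sigma\,u(m^2_A,m^2_B)$ (arrows $A,B,A,B\to A\otimes B$, where $\sigma$ exchanges the two middle places, so that $m^2_A$ is fed the two $A$'s and $m^2_B$ the two $B$'s) and $m^0_{A\otimes B}=u(m^0_A,m^0_B)$. The unit is $I$, with universal $0$-ary $u:\ \to I$ and monoid structure determined by $m^2_I(u,u)=u=m^0_I$. *)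

theory Defs
  imports "HOL-Combinatorics.Permutations"
begin

section \<open>Permutations of concatenated lists\<close>

text \<open>
  A permutation \<open>p\<close> of \<open>{..<length xs}\<close> acts on lists from the right by \<open>permute_list p xs\<close>,
  the list with \<open>i\<close>-th entry \<open>xs ! p i\<close>. The permutations occurring in the equivariance laws of a
  multicategory are described by what they do to a list cut into consecutive blocks of lengths
  \<open>ns\<close>: \<open>block_perm p ns\<close> permutes the blocks by \<open>p\<close>, and \<open>sum_perm ps ns\<close> permutes the entries of
  the \<open>k\<close>-th block by \<open>ps ! k\<close>; see the lemmas \<open>permute_list_block_perm\<close> and
  \<open>permute_list_sum_perm\<close>.
\<close>

definition index_blocks :: "nat list \<Rightarrow> nat list list" where
  "index_blocks ns = map (\<lambda>k. [sum_list (take k ns)..<sum_list (take (Suc k) ns)]) [0..<length ns]"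

definition perm_of_list :: "nat list \<Rightarrow> nat \<Rightarrow> nat" where
  "perm_of_list is i = (if i < length is then is ! i else i)"

definition block_perm :: "(nat \<Rightarrow> nat) \<Rightarrow> nat list \<Rightarrow> nat \<Rightarrow> nat" where
  "block_perm p ns = perm_of_list (concat (permute_list p (index_blocks ns)))"

definition sum_perm :: "(nat \<Rightarrow> nat) list \<Rightarrow> nat list \<Rightarrow> nat \<Rightarrow> nat" where
  "sum_perm ps ns = perm_of_list (concat (map2 permute_list ps (index_blocks ns)))"

lemma length_index_blocks [simp]: "length (index_blocks ns) = length ns"
  by (simp add: index_blocks_def)

lemma nth_index_blocks:
  "k < length ns \<Longrightarrow> index_blocks ns ! k = [sum_list (take k ns)..<sum_list (take (Suc k) ns)]"
  by (simp add: index_blocks_def)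

lemma length_nth_index_blocks: "k < length ns \<Longrightarrow> length (index_blocks ns ! k) = ns ! k"
  by (simp add: nth_index_blocks take_Suc_conv_app_nth)

lemma index_blocks_snoc:
  "index_blocks (ns @ [n]) = index_blocks ns @ [[sum_list ns..<sum_list ns + n]]"
  by (rule nth_equalityI) (auto simp: nth_index_blocks nth_append less_Suc_eq_le)

lemma concat_index_blocks: "concat (index_blocks ns) = [0..<sum_list ns]"
  by (induction ns rule: rev_induct)
    (simp_all add: index_blocks_snoc upt_add_eq_append[symmetric] index_blocks_def[of "[]"])

lemma map_nth_index_blocks:
  "map (map ((!) (concat xss))) (index_blocks (map length xss)) = xss"
proof (induction xss rule: rev_induct)
  case (snoc xs xss)
  have len: "sum_list (map length xss) = length (concat xss)"
    by (simp add: length_concat)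
  have "map (map ((!) (concat xss @ xs))) (index_blocks (map length xss))
      = map (map ((!) (concat xss))) (index_blocks (map length xss))"
  proof (intro map_cong refl)
    fix b i assume "b \<in> set (index_blocks (map length xss))" "i \<in> set b"
    then have "i \<in> set (concat (index_blocks (map length xss)))" by auto
    then have "i < length (concat xss)" unfolding concat_index_blocks len by simp
    then show "(concat xss @ xs) ! i = concat xss ! i" by (simp add: nth_append)
  qed
  moreover have "map ((!) (concat xss @ xs)) [length (concat xss)..<length (concat xss) + length xs] = xs"
    by (rule nth_equalityI) (auto simp: nth_append)
  ultimately show ?case using snoc by (simp add: index_blocks_snoc len)
qed (simp add: index_blocks_def)

lemma perm_of_list_permutes:
  assumes "mset is = mset [0..<n]"
  shows "perm_of_list is permutes {..<n}"
proof -
  have len: "length is = n"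
    using mset_eq_length[OF assms] by (simp only: length_upt diff_zero)
  have st: "set is = {..<n}"
    using mset_eq_setD[OF assms] by (simp only: set_upt atLeast0LessThan)
  show ?thesis
  proof (rule bij_imp_permutes)
    have "perm_of_list is ` {..<n} = (!) is ` {..<length is}"
      unfolding len by (intro image_cong) (simp_all add: perm_of_list_def len)
    also have "\<dots> = {..<n}"
      unfolding st[symmetric] set_conv_nth by auto
    finally show "bij_betw (perm_of_list is) {..<n} {..<n}"
      by (intro bij_betw_imageI) (simp_all add: finite_surj_inj)
    show "perm_of_list is i = i" if "i \<notin> {..<n}" for i
      using that by (simp add: perm_of_list_def len)
  qed
qed

lemma permute_list_perm_of_list:
  "length is = length xs \<Longrightarrow> permute_list (perm_of_list is) xs = map ((!) xs) is"
  by (rule nth_equalityI) (auto simp: permute_list_def perm_of_list_def)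

lemma mset_concat_permute_list:
  "p permutes {..<length xss} \<Longrightarrow> mset (concat (permute_list p xss)) = mset (concat xss)"
  unfolding mset_concat sum_mset_sum_list[symmetric] mset_map by simp

lemma mset_concat_map2_permute_list:
  assumes "length ps = length xss" "\<And>k. k < length xss \<Longrightarrow> ps ! k permutes {..<length (xss ! k)}"
  shows "mset (concat (map2 permute_list ps xss)) = mset (concat xss)"
proof -
  have "map mset (map2 permute_list ps xss) = map mset xss"
    using assms by (intro nth_equalityI) auto
  then show ?thesis by (simp add: mset_concat)
qed

lemma block_perm_permutes:
  "p permutes {..<length ns} \<Longrightarrow> block_perm p ns permutes {..<sum_list ns}"
  unfolding block_perm_def
  by (rule perm_of_list_permutes) (simp only: mset_concat_permute_list length_index_blocks concat_index_blocks)

lemma sum_perm_permutes: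
  assumes "length ps = length ns" "\<And>k. k < length ns \<Longrightarrow> ps ! k permutes {..<ns ! k}"
  shows "sum_perm ps ns permutes {..<sum_list ns}"
  unfolding sum_perm_def
  by (rule perm_of_list_permutes, subst mset_concat_map2_permute_list)
    (use assms in \<open>simp_all add: length_nth_index_blocks concat_index_blocks\<close>)

lemma permute_list_block_perm:
  assumes "p permutes {..<length xss}"
  shows "permute_list (block_perm p (map length xss)) (concat xss) = concat (permute_list p xss)"
proof -
  let ?is = "index_blocks (map length xss)"
  have "mset (concat (permute_list p ?is)) = mset (concat ?is)"
    using assms by (intro mset_concat_permute_list) simp
  then have "length (concat (permute_list p ?is)) = length (concat ?is)"
    by (rule mset_eq_length)
  also have "\<dots> = length (concat xss)"
    unfolding concat_index_blocks by (simp add: length_concat)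
  finally have "permute_list (block_perm p (map length xss)) (concat xss)
      = concat (map (map ((!) (concat xss))) (permute_list p ?is))"
    unfolding block_perm_def by (subst permute_list_perm_of_list) (simp_all add: map_concat)
  also have "map (map ((!) (concat xss))) (permute_list p ?is) = permute_list p xss"
    using assms by (simp add: permute_list_map[symmetric] map_nth_index_blocks)
  finally show ?thesis .
qed

lemma permute_list_sum_perm:
  assumes "length ps = length xss" "\<And>k. k < length xss \<Longrightarrow> ps ! k permutes {..<length (xss ! k)}"
  shows "permute_list (sum_perm ps (map length xss)) (concat xss) = concat (map2 permute_list ps xss)"
proof -
  let ?is = "index_blocks (map length xss)"
  have "mset (concat (map2 permute_list ps ?is)) = mset (concat ?is)"
    using assms by (intro mset_concat_map2_permute_list) (simp_all add: length_nth_index_blocks)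
  then have "length (concat (map2 permute_list ps ?is)) = length (concat ?is)"
    by (rule mset_eq_length)
  also have "\<dots> = length (concat xss)"
    unfolding concat_index_blocks by (simp add: length_concat)
  finally have "permute_list (sum_perm ps (map length xss)) (concat xss)
      = concat (map (map ((!) (concat xss))) (map2 permute_list ps ?is))"
    unfolding sum_perm_def by (subst permute_list_perm_of_list) (simp_all add: map_concat)
  also have "map (map ((!) (concat xss))) (map2 permute_list ps ?is) = map2 permute_list ps xss"
  proof (rule nth_equalityI)
    fix k assume "k < length (map (map ((!) (concat xss))) (map2 permute_list ps ?is))"
    then have k: "k < length xss" by simp
    have "map ((!) (concat xss)) (permute_list (ps ! k) (?is ! k))
        = permute_list (ps ! k) (map ((!) (concat xss)) (?is ! k))"
      using assms k by (subst permute_list_map) (simp_all add: length_nth_index_blocks)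
    also have "map ((!) (concat xss)) (?is ! k) = xss ! k"
      using k arg_cong[OF map_nth_index_blocks[of xss], of "\<lambda>l. l ! k"] by simp
    finally show "map (map ((!) (concat xss))) (map2 permute_list ps ?is) ! k = map2 permute_list ps xss ! k"
      using assms k by simp
  qed (use assms in simp)
  finally show ?thesis .
qed


section \<open>Symmetric multicategories\<close>

record ('o, 'a) multicat =
  Obj :: "'o set"
  Arr :: "'a set"
  src :: "'a \<Rightarrow> 'o list"
  trg :: "'a \<Rightarrow> 'o"
  idn :: "'o \<Rightarrow> 'a"
  cmp :: "'a \<Rightarrow> 'a list \<Rightarrow> 'a"
  act :: "(nat \<Rightarrow> nat) \<Rightarrow> 'a \<Rightarrow> 'a"

text \<open>
  \<open>cmp M f [g\<^sub>1, \<dots>, g\<^sub>n]\<close> is the multicategorical composite \<open>f(g\<^sub>1, \<dots>, g\<^sub>n)\<close>, and \<open>act M p f\<close> is the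
  (right) action of \<open>p\<close> on \<open>f\<close>: if \<open>f : A\<^sub>0, \<dots>, A\<^sub>n \<rightarrow> B\<close>, then
  \<open>act M p f : A\<^bsub>p 0\<^esub>, \<dots>, A\<^bsub>p n\<^esub> \<rightarrow> B\<close>.
\<close>

definition mhom :: "('o, 'a, 'm) multicat_scheme \<Rightarrow> 'o list \<Rightarrow> 'o \<Rightarrow> 'a set" where
  "mhom M As B = {f \<in> Arr M. src M f = As \<and> trg M f = B}"

definition composable :: "('o, 'a, 'm) multicat_scheme \<Rightarrow> 'a \<Rightarrow> 'a list \<Rightarrow> bool" where
  "composable M f gs \<longleftrightarrow> f \<in> Arr M \<and> set gs \<subseteq> Arr M \<and> map (trg M) gs = src M f"

locale symmetric_multicategory =
  fixes M :: "('o, 'a, 'm) multicat_scheme" (structure)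
  assumes src_Obj: "f \<in> Arr M \<Longrightarrow> set (src M f) \<subseteq> Obj M"
    and trg_Obj: "f \<in> Arr M \<Longrightarrow> trg M f \<in> Obj M"
    and idn_mhom: "A \<in> Obj M \<Longrightarrow> idn M A \<in> mhom M [A] A"
    and cmp_mhom: "composable M f gs \<Longrightarrow> cmp M f gs \<in> mhom M (concat (map (src M) gs)) (trg M f)"
    and cmp_idn_right: "f \<in> Arr M \<Longrightarrow> cmp M f (map (idn M) (src M f)) = f"
    and cmp_idn_left: "f \<in> Arr M \<Longrightarrow> cmp M (idn M (trg M f)) [f] = f"
    and cmp_assoc: "composable M f gs \<Longrightarrow> list_all2 (composable M) gs hss \<Longrightarrow>
          cmp M (cmp M f gs) (concat hss) = cmp M f (map2 (cmp M) gs hss)"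
    and act_mhom: "f \<in> Arr M \<Longrightarrow> p permutes {..<length (src M f)} \<Longrightarrow>
          act M p f \<in> mhom M (permute_list p (src M f)) (trg M f)"
    and act_id: "f \<in> Arr M \<Longrightarrow> act M id f = f"
    and act_act: "f \<in> Arr M \<Longrightarrow> p permutes {..<length (src M f)} \<Longrightarrow> q permutes {..<length (src M f)} \<Longrightarrow>
          act M q (act M p f) = act M (p \<circ> q) f"
    and cmp_act_left: "composable M f gs \<Longrightarrow> p permutes {..<length gs} \<Longrightarrow>
          cmp M (act M p f) (permute_list p gs) =
            act M (block_perm p (map (\<lambda>g. length (src M g)) gs)) (cmp M f gs)"
    and cmp_act_right: "composable M f gs \<Longrightarrow> list_all2 (\<lambda>p g. p permutes {..<length (src M g)}) ps gs \<Longrightarrow>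
          cmp M f (map2 (act M) ps gs) =
            act M (sum_perm ps (map (\<lambda>g. length (src M g)) gs)) (cmp M f gs)"

definition preuniversal :: "('o, 'a, 'm) multicat_scheme \<Rightarrow> 'a \<Rightarrow> bool" where
  "preuniversal M u \<longleftrightarrow> u \<in> Arr M \<and>
     (\<forall>B \<in> Obj M. bij_betw (\<lambda>f. cmp M f [u]) (mhom M [trg M u] B) (mhom M (src M u) B))"

definition representable :: "('o, 'a, 'm) multicat_scheme \<Rightarrow> bool" where
  "representable M \<longleftrightarrow>
     (\<forall>As. set As \<subseteq> Obj M \<longrightarrow> (\<exists>u. preuniversal M u \<and> src M u = As)) \<and>
     (\<forall>u vs. composable M u vs \<and> preuniversal M u \<and> (\<forall>v \<in> set vs. preuniversal M v)
        \<longrightarrow> preuniversal M (cmp M u vs))"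

text \<open>
  If \<open>vs\<close> are universal arrows, \<open>factor M vs f\<close> is the unique \<open>g\<close> with \<open>g(vs) = f\<close>; existence and
  uniqueness are \<open>ex1_factor\<close> below.
\<close>

definition factor :: "('o, 'a, 'm) multicat_scheme \<Rightarrow> 'a list \<Rightarrow> 'a \<Rightarrow> 'a" where
  "factor M vs f = (THE g. g \<in> mhom M (map (trg M) vs) (trg M f) \<and> cmp M g vs = f)"

lemma (in symmetric_multicategory) ex1_factor:
  assumes rep: "representable M" and vs: "\<forall>v \<in> set vs. preuniversal M v"
    and f: "f \<in> mhom M (concat (map (src M) vs)) B"
  shows "\<exists>!g. g \<in> mhom M (map (trg M) vs) B \<and> cmp M g vs = f"
proof -
  have vsA: "set vs \<subseteq> Arr M" using vs by (auto simp: preuniversal_def)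
  then have "set (map (trg M) vs) \<subseteq> Obj M" using trg_Obj by auto
  then obtain w where w: "preuniversal M w" "src M w = map (trg M) vs"
    using rep unfolding representable_def by blast
  have wA: "w \<in> Arr M" using w by (simp add: preuniversal_def)
  have wvs: "composable M w vs" using wA vsA w by (simp add: composable_def)
  define v where "v = cmp M w vs"
  have v: "preuniversal M v" using rep wvs w vs unfolding representable_def v_def by blast
  have v': "src M v = concat (map (src M) vs)" "trg M v = trg M w"
    using cmp_mhom[OF wvs] by (simp_all add: v_def mhom_def)
  have B: "B \<in> Obj M" using f trg_Obj by (auto simp: mhom_def)
  have bw: "bij_betw (\<lambda>f. cmp M f [w]) (mhom M [trg M w] B) (mhom M (map (trg M) vs) B)"
    using w B by (simp add: preuniversal_def)
  have bv: "bij_betw (\<lambda>f. cmp M f [v]) (mhom M [trg M w] B) (mhom M (concat (map (src M) vs)) B)"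
    using v v' B by (simp add: preuniversal_def)
  have eq: "cmp M (cmp M k [w]) vs = cmp M k [v]" if "k \<in> mhom M [trg M w] B" for k
  proof -
    have "composable M k [w]" using that wA by (simp add: composable_def mhom_def)
    then show ?thesis using cmp_assoc[of k "[w]" "[vs]"] wvs by (simp add: v_def)
  qed
  show ?thesis
  proof (rule ex_ex1I)
    obtain k where k: "k \<in> mhom M [trg M w] B" "cmp M k [v] = f"
      using bv f unfolding bij_betw_def by (metis (no_types, lifting) imageE)
    then show "\<exists>g. g \<in> mhom M (map (trg M) vs) B \<and> cmp M g vs = f"
      using eq bij_betwE[OF bw] by blast
  next
    fix g g' assume g: "g \<in> mhom M (map (trg M) vs) B \<and> cmp M g vs = f"
      and g': "g' \<in> mhom M (map (trg M) vs) B \<and> cmp M g' vs = f"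
    obtain k where k: "k \<in> mhom M [trg M w] B" "cmp M k [w] = g"
      using bw g unfolding bij_betw_def by (metis (no_types, lifting) imageE)
    obtain k' where k': "k' \<in> mhom M [trg M w] B" "cmp M k' [w] = g'"
      using bw g' unfolding bij_betw_def by (metis (no_types, lifting) imageE)
    have "cmp M k [v] = cmp M k' [v]" using eq k k' g g' by metis
    then have "k = k'" using bv k(1) k'(1) unfolding bij_betw_def inj_on_def by blast
    then show "g = g'" using k k' by simp
  qed
qed

lemma (in symmetric_multicategory) factor:
  assumes "representable M" "\<forall>v \<in> set vs. preuniversal M v"
    and "f \<in> mhom M (concat (map (src M) vs)) B"
  shows "factor M vs f \<in> mhom M (map (trg M) vs) B" "cmp M (factor M vs f) vs = f"
proof -
  have "trg M f = B" using assms(3) by (simp add: mhom_def)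
  then show "factor M vs f \<in> mhom M (map (trg M) vs) B" "cmp M (factor M vs f) vs = f"
    using theI'[OF ex1_factor[OF assms]] by (simp_all add: factor_def)
qed


section \<open>Cocartesian monoidal categories\<close>

record ('x, 'f) cat =
  Ob :: "'x set"
  Ar :: "'f set"
  Dom :: "'f \<Rightarrow> 'x"
  Cod :: "'f \<Rightarrow> 'x"
  Ide :: "'x \<Rightarrow> 'f"
  Comp :: "'f \<Rightarrow> 'f \<Rightarrow> 'f"  (infixl "\<cdot>\<index>" 60)

definition hom :: "('x, 'f, 'm) cat_scheme \<Rightarrow> 'x \<Rightarrow> 'x \<Rightarrow> 'f set" where
  "hom C x y = {f \<in> Ar C. Dom C f = x \<and> Cod C f = y}"

locale category =
  fixes C :: "('x, 'f, 'm) cat_scheme" (structure)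
  assumes Dom_Ob: "f \<in> Ar C \<Longrightarrow> Dom C f \<in> Ob C"
    and Cod_Ob: "f \<in> Ar C \<Longrightarrow> Cod C f \<in> Ob C"
    and Ide_hom: "x \<in> Ob C \<Longrightarrow> Ide C x \<in> hom C x x"
    and Comp_hom: "f \<in> hom C x y \<Longrightarrow> g \<in> hom C y z \<Longrightarrow> g \<cdot> f \<in> hom C x z"
    and Comp_Ide: "f \<in> hom C x y \<Longrightarrow> f \<cdot> Ide C x = f"
    and Ide_Comp: "f \<in> hom C x y \<Longrightarrow> Ide C y \<cdot> f = f"
    and Comp_assoc: "f \<in> hom C w x \<Longrightarrow> g \<in> hom C x y \<Longrightarrow> h \<in> hom C y z \<Longrightarrow> (h \<cdot> g) \<cdot> f = h \<cdot> (g \<cdot> f)"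

definition inverse_arrows :: "('x, 'f, 'm) cat_scheme \<Rightarrow> 'f \<Rightarrow> 'f \<Rightarrow> bool" where
  "inverse_arrows C f g \<longleftrightarrow> f \<in> Ar C \<and> g \<in> hom C (Cod C f) (Dom C f) \<and>
     g \<cdot>\<^bsub>C\<^esub> f = Ide C (Dom C f) \<and> f \<cdot>\<^bsub>C\<^esub> g = Ide C (Cod C f)"

definition iso_arrow :: "('x, 'f, 'm) cat_scheme \<Rightarrow> 'f \<Rightarrow> bool" where
  "iso_arrow C f \<longleftrightarrow> (\<exists>g. inverse_arrows C f g)"

definition inv_arrow :: "('x, 'f, 'm) cat_scheme \<Rightarrow> 'f \<Rightarrow> 'f" where
  "inv_arrow C f = (THE g. inverse_arrows C f g)"

definition initial_object :: "('x, 'f, 'm) cat_scheme \<Rightarrow> 'x \<Rightarrow> bool" where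
  "initial_object C i \<longleftrightarrow> i \<in> Ob C \<and> (\<forall>x \<in> Ob C. \<exists>!f. f \<in> hom C i x)"

definition binary_sum :: "('x, 'f, 'm) cat_scheme \<Rightarrow> 'x \<Rightarrow> 'x \<Rightarrow> 'x \<Rightarrow> 'f \<Rightarrow> 'f \<Rightarrow> bool" where
  "binary_sum C x y s i j \<longleftrightarrow> i \<in> hom C x s \<and> j \<in> hom C y s \<and>
     (\<forall>z. \<forall>f \<in> hom C x z. \<forall>g \<in> hom C y z.
        \<exists>!h. h \<in> hom C s z \<and> h \<cdot>\<^bsub>C\<^esub> i = f \<and> h \<cdot>\<^bsub>C\<^esub> j = g)"

record ('x, 'f) moncat = "('x, 'f) cat" +
  TenO :: "'x \<Rightarrow> 'x \<Rightarrow> 'x"  (infixl "\<otimes>\<index>" 70)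
  TenA :: "'f \<Rightarrow> 'f \<Rightarrow> 'f"  (infixl "\<odot>\<index>" 70)
  Unit :: "'x"
  Assoc :: "'x \<Rightarrow> 'x \<Rightarrow> 'x \<Rightarrow> 'f"
  Lunit :: "'x \<Rightarrow> 'f"
  Runit :: "'x \<Rightarrow> 'f"
  Braid :: "'x \<Rightarrow> 'x \<Rightarrow> 'f"

text \<open>\<open>\<otimes>\<close> is the tensor product of objects and \<open>\<odot>\<close> that of arrows.\<close>

locale symmetric_monoidal_category = category C
  for C :: "('x, 'f, 'm) moncat_scheme" (structure) +
  assumes TenO_Ob: "x \<in> Ob C \<Longrightarrow> y \<in> Ob C \<Longrightarrow> x \<otimes> y \<in> Ob C"
    and TenA_hom: "f \<in> hom C x x' \<Longrightarrow> g \<in> hom C y y' \<Longrightarrow> f \<odot> g \<in> hom C (x \<otimes> y) (x' \<otimes> y')"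
    and TenA_Ide: "x \<in> Ob C \<Longrightarrow> y \<in> Ob C \<Longrightarrow> Ide C x \<odot> Ide C y = Ide C (x \<otimes> y)"
    and TenA_Comp: "f \<in> hom C x x' \<Longrightarrow> f' \<in> hom C x' x'' \<Longrightarrow> g \<in> hom C y y' \<Longrightarrow> g' \<in> hom C y' y'' \<Longrightarrow>
          (f' \<cdot> f) \<odot> (g' \<cdot> g) = (f' \<odot> g') \<cdot> (f \<odot> g)"
    and Unit_Ob: "Unit C \<in> Ob C"
    and Assoc_hom: "x \<in> Ob C \<Longrightarrow> y \<in> Ob C \<Longrightarrow> z \<in> Ob C \<Longrightarrow>
          Assoc C x y z \<in> hom C (x \<otimes> y \<otimes> z) (x \<otimes> (y \<otimes> z))"
    and Assoc_iso: "x \<in> Ob C \<Longrightarrow> y \<in> Ob C \<Longrightarrow> z \<in> Ob C \<Longrightarrow> iso_arrow C (Assoc C x y z)"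
    and Assoc_natural: "f \<in> hom C x x' \<Longrightarrow> g \<in> hom C y y' \<Longrightarrow> h \<in> hom C z z' \<Longrightarrow>
          Assoc C x' y' z' \<cdot> (f \<odot> g \<odot> h) = (f \<odot> (g \<odot> h)) \<cdot> Assoc C x y z"
    and Lunit_hom: "x \<in> Ob C \<Longrightarrow> Lunit C x \<in> hom C (Unit C \<otimes> x) x"
    and Lunit_iso: "x \<in> Ob C \<Longrightarrow> iso_arrow C (Lunit C x)"
    and Lunit_natural: "f \<in> hom C x y \<Longrightarrow> Lunit C y \<cdot> (Ide C (Unit C) \<odot> f) = f \<cdot> Lunit C x"
    and Runit_hom: "x \<in> Ob C \<Longrightarrow> Runit C x \<in> hom C (x \<otimes> Unit C) x"
    and Runit_iso: "x \<in> Ob C \<Longrightarrow> iso_arrow C (Runit C x)"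
    and Runit_natural: "f \<in> hom C x y \<Longrightarrow> Runit C y \<cdot> (f \<odot> Ide C (Unit C)) = f \<cdot> Runit C x"
    and Braid_hom: "x \<in> Ob C \<Longrightarrow> y \<in> Ob C \<Longrightarrow> Braid C x y \<in> hom C (x \<otimes> y) (y \<otimes> x)"
    and Braid_natural: "f \<in> hom C x x' \<Longrightarrow> g \<in> hom C y y' \<Longrightarrow>
          Braid C x' y' \<cdot> (f \<odot> g) = (g \<odot> f) \<cdot> Braid C x y"
    and Braid_Braid: "x \<in> Ob C \<Longrightarrow> y \<in> Ob C \<Longrightarrow> Braid C y x \<cdot> Braid C x y = Ide C (x \<otimes> y)"
    and pentagon: "w \<in> Ob C \<Longrightarrow> x \<in> Ob C \<Longrightarrow> y \<in> Ob C \<Longrightarrow> z \<in> Ob C \<Longrightarrow>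
          Assoc C w x (y \<otimes> z) \<cdot> Assoc C (w \<otimes> x) y z =
          (Ide C w \<odot> Assoc C x y z) \<cdot> Assoc C w (x \<otimes> y) z \<cdot> (Assoc C w x y \<odot> Ide C z)"
    and triangle: "x \<in> Ob C \<Longrightarrow> y \<in> Ob C \<Longrightarrow>
          (Ide C x \<odot> Lunit C y) \<cdot> Assoc C x (Unit C) y = Runit C x \<odot> Ide C y"
    and hexagon: "x \<in> Ob C \<Longrightarrow> y \<in> Ob C \<Longrightarrow> z \<in> Ob C \<Longrightarrow>
          Assoc C y z x \<cdot> Braid C x (y \<otimes> z) \<cdot> Assoc C x y z =
          (Ide C y \<odot> Braid C x z) \<cdot> Assoc C y x z \<cdot> (Braid C x y \<odot> Ide C z)"

text \<open>
  When the unit is initial, there are canonical arrows \<open>x \<cong> x \<otimes> I \<rightarrow> x \<otimes> y\<close> and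
  \<open>y \<cong> I \<otimes> y \<rightarrow> x \<otimes> y\<close>; these are required to be the injections of a binary sum.
\<close>

definition from_unit :: "('x, 'f, 'm) moncat_scheme \<Rightarrow> 'x \<Rightarrow> 'f" where
  "from_unit C x = (THE f. f \<in> hom C (Unit C) x)"

definition inl_tensor :: "('x, 'f, 'm) moncat_scheme \<Rightarrow> 'x \<Rightarrow> 'x \<Rightarrow> 'f" where
  "inl_tensor C x y = (Ide C x \<odot>\<^bsub>C\<^esub> from_unit C y) \<cdot>\<^bsub>C\<^esub> inv_arrow C (Runit C x)"

definition inr_tensor :: "('x, 'f, 'm) moncat_scheme \<Rightarrow> 'x \<Rightarrow> 'x \<Rightarrow> 'f" where
  "inr_tensor C x y = (from_unit C x \<odot>\<^bsub>C\<^esub> Ide C y) \<cdot>\<^bsub>C\<^esub> inv_arrow C (Lunit C y)"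

locale cocartesian_monoidal_category = symmetric_monoidal_category C
  for C :: "('x, 'f, 'm) moncat_scheme" (structure) +
  assumes Unit_initial: "initial_object C (Unit C)"
    and TenO_sum: "x \<in> Ob C \<Longrightarrow> y \<in> Ob C \<Longrightarrow>
          binary_sum C x y (x \<otimes> y) (inl_tensor C x y) (inr_tensor C x y)"


section \<open>Commutative monoids in a symmetric multicategory\<close>

record ('o, 'a) cmon =
  carr :: "'o"
  mul0 :: "'a"
  mul2 :: "'a"

definition commutative_monoid :: "('o, 'a, 'm) multicat_scheme \<Rightarrow> ('o, 'a) cmon \<Rightarrow> bool" where
  "commutative_monoid M X \<longleftrightarrow>
     carr X \<in> Obj M \<and> mul0 X \<in> mhom M [] (carr X) \<and> mul2 X \<in> mhom M [carr X, carr X] (carr X) \<and>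
     cmp M (mul2 X) [mul0 X, idn M (carr X)] = idn M (carr X) \<and>
     cmp M (mul2 X) [idn M (carr X), mul0 X] = idn M (carr X) \<and>
     cmp M (mul2 X) [mul2 X, idn M (carr X)] = cmp M (mul2 X) [idn M (carr X), mul2 X] \<and>
     act M (transpose 0 1) (mul2 X) = mul2 X"

definition cmon_morphism ::
  "('o, 'a, 'm) multicat_scheme \<Rightarrow> ('o, 'a) cmon \<Rightarrow> ('o, 'a) cmon \<Rightarrow> 'a \<Rightarrow> bool" where
  "cmon_morphism M X Y f \<longleftrightarrow> f \<in> mhom M [carr X] (carr Y) \<and>
     cmp M f [mul0 X] = mul0 Y \<and> cmp M f [mul2 X] = cmp M (mul2 Y) [f, f]"

text \<open>Arrows of \<open>cMon M\<close> are triples consisting of domain, underlying arrow of \<open>M\<close>, and codomain.\<close>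

type_synonym ('o, 'a) cmon_arrow = "('o, 'a) cmon \<times> 'a \<times> ('o, 'a) cmon"

definition cMon :: "('o, 'a, 'm) multicat_scheme \<Rightarrow> (('o, 'a) cmon, ('o, 'a) cmon_arrow) cat" where
  "cMon M =
    \<lparr>Ob = {X. commutative_monoid M X},
     Ar = {(X, f, Y). commutative_monoid M X \<and> commutative_monoid M Y \<and> cmon_morphism M X Y f},
     Dom = (\<lambda>(X, f, Y). X),
     Cod = (\<lambda>(X, f, Y). Y),
     Ide = (\<lambda>X. (X, idn M (carr X), X)),
     Comp = (\<lambda>(Y, g, Z) (X, f, Y'). (X, cmp M g [f], Z))\<rparr>"


section \<open>The tensor product inherited from a representable multicategory\<close>

text \<open>
  A choice of universal arrows \<open>t A B : A, B \<rightarrow> A \<otimes> B\<close> and \<open>e : \<rightarrow> I\<close>. All of the structure below is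
  relative to such a choice.
\<close>

locale tensor_choice =
  fixes M :: "('o, 'a, 'm) multicat_scheme" (structure)
    and t :: "'o \<Rightarrow> 'o \<Rightarrow> 'a"
    and e :: "'a"
  assumes t_universal: "A \<in> Obj M \<Longrightarrow> B \<in> Obj M \<Longrightarrow> preuniversal M (t A B)"
    and src_t: "A \<in> Obj M \<Longrightarrow> B \<in> Obj M \<Longrightarrow> src M (t A B) = [A, B]"
    and e_universal: "preuniversal M e"
    and src_e: "src M e = []"

text \<open>
  With \<open>u = t A B\<close>, the multiplication \<open>m\<close> of the tensor product of \<open>X\<close> (on \<open>A\<close>) and \<open>Y\<close> (on \<open>B\<close>)
  is determined by \<open>m(u, u) = \<sigma> u(m\<^sub>X, m\<^sub>Y)\<close>, where \<open>\<sigma>\<close> turns an arrow \<open>A, A, B, B \<rightarrow> A \<otimes> B\<close> into an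
  arrow \<open>A, B, A, B \<rightarrow> A \<otimes> B\<close> by exchanging the two middle places.
\<close>

definition tensor_cmon ::
  "('o, 'a, 'm) multicat_scheme \<Rightarrow> ('o \<Rightarrow> 'o \<Rightarrow> 'a) \<Rightarrow> ('o, 'a) cmon \<Rightarrow> ('o, 'a) cmon \<Rightarrow> ('o, 'a) cmon" where
  "tensor_cmon M t X Y = (let u = t (carr X) (carr Y) in
    \<lparr>carr = trg M u,
     mul0 = cmp M u [mul0 X, mul0 Y],
     mul2 = factor M [u, u] (act M (transpose 1 2) (cmp M u [mul2 X, mul2 Y]))\<rparr>)"

definition unit_cmon :: "('o, 'a, 'm) multicat_scheme \<Rightarrow> 'a \<Rightarrow> ('o, 'a) cmon" where
  "unit_cmon M e = \<lparr>carr = trg M e, mul0 = e, mul2 = factor M [e, e] e\<rparr>"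

text \<open>
  The remaining structure of the symmetric monoidal category corresponding to \<open>M\<close>; for instance, the
  associator \<open>a\<close> is determined by \<open>a(t(t, 1)) = t(1, t)\<close> as arrows \<open>A, B, C \<rightarrow> A \<otimes> (B \<otimes> C)\<close>.
\<close>

definition tensor_arrow ::
  "('o, 'a, 'm) multicat_scheme \<Rightarrow> ('o \<Rightarrow> 'o \<Rightarrow> 'a) \<Rightarrow> 'o \<Rightarrow> 'o \<Rightarrow> 'o \<Rightarrow> 'o \<Rightarrow> 'a \<Rightarrow> 'a \<Rightarrow> 'a" where
  "tensor_arrow M t A A' B B' f g = factor M [t A B] (cmp M (t A' B') [f, g])"

definition tensor_assoc ::
  "('o, 'a, 'm) multicat_scheme \<Rightarrow> ('o \<Rightarrow> 'o \<Rightarrow> 'a) \<Rightarrow> 'o \<Rightarrow> 'o \<Rightarrow> 'o \<Rightarrow> 'a" where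
  "tensor_assoc M t A B C =
     factor M [cmp M (t (trg M (t A B)) C) [t A B, idn M C]]
       (cmp M (t A (trg M (t B C))) [idn M A, t B C])"

definition tensor_lunit ::
  "('o, 'a, 'm) multicat_scheme \<Rightarrow> ('o \<Rightarrow> 'o \<Rightarrow> 'a) \<Rightarrow> 'a \<Rightarrow> 'o \<Rightarrow> 'a" where
  "tensor_lunit M t e A = factor M [cmp M (t (trg M e) A) [e, idn M A]] (idn M A)"

definition tensor_runit ::
  "('o, 'a, 'm) multicat_scheme \<Rightarrow> ('o \<Rightarrow> 'o \<Rightarrow> 'a) \<Rightarrow> 'a \<Rightarrow> 'o \<Rightarrow> 'a" where
  "tensor_runit M t e A = factor M [cmp M (t A (trg M e)) [idn M A, e]] (idn M A)"

definition tensor_braid ::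
  "('o, 'a, 'm) multicat_scheme \<Rightarrow> ('o \<Rightarrow> 'o \<Rightarrow> 'a) \<Rightarrow> 'o \<Rightarrow> 'o \<Rightarrow> 'a" where
  "tensor_braid M t A B = factor M [t A B] (act M (transpose 0 1) (t B A))"

definition cMon_monoidal ::
  "('o, 'a, 'm) multicat_scheme \<Rightarrow> ('o \<Rightarrow> 'o \<Rightarrow> 'a) \<Rightarrow> 'a \<Rightarrow>
   (('o, 'a) cmon, ('o, 'a) cmon_arrow) moncat" where
  "cMon_monoidal M t e = (let T = tensor_cmon M t; I = unit_cmon M e in
     cat.extend (cMon M) (moncat.fields
       T
       (\<lambda>(X, f, X') (Y, g, Y').
          (T X Y, tensor_arrow M t (carr X) (carr X') (carr Y) (carr Y') f g, T X' Y'))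
       I
       (\<lambda>X Y Z. (T (T X Y) Z, tensor_assoc M t (carr X) (carr Y) (carr Z), T X (T Y Z)))
       (\<lambda>X. (T I X, tensor_lunit M t e (carr X), X))
       (\<lambda>X. (T X I, tensor_runit M t e (carr X), X))
       (\<lambda>X Y. (T X Y, tensor_braid M t (carr X) (carr Y), T Y X))))"

end

theory Submission
  imports Defs
begin

text \<open>
  An arrow of \<open>M\<close> together with labels for its inputs, taken up to simultaneous permutation of the
  labels and the inputs, is regarded as a generalised element of its target. Arrows act on such
  elements, the symmetric action becomes invisible, and two arrows are equal if they act equally on
  distinctly labelled variables; it even suffices to test them on elements of the form \<open>v(a\<^sub>1, \<dots>, a\<^sub>n)\<close>
  with \<open>v\<close> universal. In these terms a commutative monoid is an ordinary one, and
  (in additive notation) \<open>X \<otimes> Y\<close> has the addition \<open>(a \<otimes> b) + (c \<otimes> d) = (a + c) \<otimes> (b + d)\<close>.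

  Hence \<open>a \<otimes> b = (a \<otimes> 0) + (0 \<otimes> b)\<close>, so \<open>a \<mapsto> a \<otimes> 0\<close> and \<open>b \<mapsto> 0 \<otimes> b\<close> are the injections of a
  binary sum, with \<open>a \<otimes> b \<mapsto> f(a) + g(b)\<close> as the copairing of \<open>f\<close> and \<open>g\<close>; commutativity makes it a
  morphism. The structural arrows of the tensor product are monoid morphisms commuting with these
  injections, so the coherence laws follow from the uniqueness of arrows out of a sum.
\<close>

section \<open>Monoidal structures given by sums\<close>

locale monoidal_sums = category C
  for C :: "('x, 'f, 'm) moncat_scheme" (structure)
    and inl inr :: "'x \<Rightarrow> 'x \<Rightarrow> 'f" +
  assumes initial: "initial_object C (Unit C)"
    and TenO_closed: "x \<in> Ob C \<Longrightarrow> y \<in> Ob C \<Longrightarrow> x \<otimes> y \<in> Ob C"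
    and sum: "x \<in> Ob C \<Longrightarrow> y \<in> Ob C \<Longrightarrow> binary_sum C x y (x \<otimes> y) (inl x y) (inr x y)"
    and TenA_in_hom: "f \<in> hom C x x' \<Longrightarrow> g \<in> hom C y y' \<Longrightarrow> f \<odot> g \<in> hom C (x \<otimes> y) (x' \<otimes> y')"
    and TenA_inl: "f \<in> hom C x x' \<Longrightarrow> g \<in> hom C y y' \<Longrightarrow> (f \<odot> g) \<cdot> inl x y = inl x' y' \<cdot> f"
    and TenA_inr: "f \<in> hom C x x' \<Longrightarrow> g \<in> hom C y y' \<Longrightarrow> (f \<odot> g) \<cdot> inr x y = inr x' y' \<cdot> g"
    and Assoc_in_hom: "x \<in> Ob C \<Longrightarrow> y \<in> Ob C \<Longrightarrow> z \<in> Ob C \<Longrightarrow>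
          Assoc C x y z \<in> hom C (x \<otimes> y \<otimes> z) (x \<otimes> (y \<otimes> z))"
    and Assoc_inl_inl: "x \<in> Ob C \<Longrightarrow> y \<in> Ob C \<Longrightarrow> z \<in> Ob C \<Longrightarrow>
          Assoc C x y z \<cdot> (inl (x \<otimes> y) z \<cdot> inl x y) = inl x (y \<otimes> z)"
    and Assoc_inl_inr: "x \<in> Ob C \<Longrightarrow> y \<in> Ob C \<Longrightarrow> z \<in> Ob C \<Longrightarrow>
          Assoc C x y z \<cdot> (inl (x \<otimes> y) z \<cdot> inr x y) = inr x (y \<otimes> z) \<cdot> inl y z"
    and Assoc_inr: "x \<in> Ob C \<Longrightarrow> y \<in> Ob C \<Longrightarrow> z \<in> Ob C \<Longrightarrow>
          Assoc C x y z \<cdot> inr (x \<otimes> y) z = inr x (y \<otimes> z) \<cdot> inr y z"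
    and Lunit_in_hom: "x \<in> Ob C \<Longrightarrow> Lunit C x \<in> hom C (Unit C \<otimes> x) x"
    and Lunit_inr: "x \<in> Ob C \<Longrightarrow> Lunit C x \<cdot> inr (Unit C) x = Ide C x"
    and Runit_in_hom: "x \<in> Ob C \<Longrightarrow> Runit C x \<in> hom C (x \<otimes> Unit C) x"
    and Runit_inl: "x \<in> Ob C \<Longrightarrow> Runit C x \<cdot> inl x (Unit C) = Ide C x"
    and Braid_in_hom: "x \<in> Ob C \<Longrightarrow> y \<in> Ob C \<Longrightarrow> Braid C x y \<in> hom C (x \<otimes> y) (y \<otimes> x)"
    and Braid_inl: "x \<in> Ob C \<Longrightarrow> y \<in> Ob C \<Longrightarrow> Braid C x y \<cdot> inl x y = inr y x"
    and Braid_inr: "x \<in> Ob C \<Longrightarrow> y \<in> Ob C \<Longrightarrow> Braid C x y \<cdot> inr x y = inl y x"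
begin

lemma homI: "f \<in> Ar C \<Longrightarrow> Dom C f = x \<Longrightarrow> Cod C f = y \<Longrightarrow> f \<in> hom C x y"
  by (simp add: hom_def)

lemma hom_simps:
  assumes "f \<in> hom C x y"
  shows "f \<in> Ar C" "Dom C f = x" "Cod C f = y" "x \<in> Ob C" "y \<in> Ob C"
  using assms Dom_Ob Cod_Ob by (auto simp: hom_def)

lemmas Ob_closed [simp] = Dom_Ob Cod_Ob TenO_closed

lemma Unit_closed [simp]: "Unit C \<in> Ob C"
  using initial by (simp add: initial_object_def)

lemma inl_in_hom: "x \<in> Ob C \<Longrightarrow> y \<in> Ob C \<Longrightarrow> inl x y \<in> hom C x (x \<otimes> y)"
  and inr_in_hom: "x \<in> Ob C \<Longrightarrow> y \<in> Ob C \<Longrightarrow> inr x y \<in> hom C y (x \<otimes> y)"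
  using sum by (simp_all add: binary_sum_def)

lemmas const_simps [simp] =
  hom_simps(1-3)[OF Ide_hom] hom_simps(1-3)[OF inl_in_hom] hom_simps(1-3)[OF inr_in_hom]
  hom_simps(1-3)[OF Assoc_in_hom] hom_simps(1-3)[OF Lunit_in_hom] hom_simps(1-3)[OF Runit_in_hom]
  hom_simps(1-3)[OF Braid_in_hom]

lemma Comp_simps [simp]:
  assumes "f \<in> Ar C" "g \<in> Ar C" "Cod C f = Dom C g"
  shows "g \<cdot> f \<in> Ar C" "Dom C (g \<cdot> f) = Dom C f" "Cod C (g \<cdot> f) = Cod C g"
  using hom_simps[OF Comp_hom[OF homI homI]] assms by simp_all

lemma TenA_simps [simp]:
  assumes "f \<in> Ar C" "g \<in> Ar C"
  shows "f \<odot> g \<in> Ar C" "Dom C (f \<odot> g) = Dom C f \<otimes> Dom C g" "Cod C (f \<odot> g) = Cod C f \<otimes> Cod C g"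
  using hom_simps[OF TenA_in_hom[OF homI homI]] assms by simp_all

lemma Comp_assoc_simp [simp]:
  "f \<in> Ar C \<Longrightarrow> g \<in> Ar C \<Longrightarrow> h \<in> Ar C \<Longrightarrow> Cod C f = Dom C g \<Longrightarrow> Cod C g = Dom C h \<Longrightarrow>
    h \<cdot> g \<cdot> f = h \<cdot> (g \<cdot> f)"
  by (rule Comp_assoc) (simp_all add: hom_def)

lemma Comp_Ide_simp [simp]: "f \<in> Ar C \<Longrightarrow> x = Dom C f \<Longrightarrow> f \<cdot> Ide C x = f"
  and Ide_Comp_simp [simp]: "f \<in> Ar C \<Longrightarrow> x = Cod C f \<Longrightarrow> Ide C x \<cdot> f = f"
  using Comp_Ide Ide_Comp by (simp_all add: hom_def)

lemma TenA_inl_simp [simp]: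
  "f \<in> Ar C \<Longrightarrow> g \<in> Ar C \<Longrightarrow> x = Dom C f \<Longrightarrow> y = Dom C g \<Longrightarrow>
    (f \<odot> g) \<cdot> inl x y = inl (Cod C f) (Cod C g) \<cdot> f"
  by (rule TenA_inl) (simp_all add: hom_def)

lemma TenA_inr_simp [simp]:
  "f \<in> Ar C \<Longrightarrow> g \<in> Ar C \<Longrightarrow> x = Dom C f \<Longrightarrow> y = Dom C g \<Longrightarrow>
    (f \<odot> g) \<cdot> inr x y = inr (Cod C f) (Cod C g) \<cdot> g"
  by (rule TenA_inr) (simp_all add: hom_def)

lemmas injection_simps [simp] =
  Assoc_inl_inl Assoc_inl_inr Assoc_inr Lunit_inr Runit_inl Braid_inl Braid_inr

lemma Comp_reassoc:
  assumes "h \<cdot> g = k" "g \<in> Ar C" "h \<in> Ar C" "Cod C g = Dom C h" "f \<in> Ar C" "Cod C f = Dom C g"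
  shows "h \<cdot> (g \<cdot> f) = k \<cdot> f"
  using assms Comp_assoc_simp[of f g h] by simp

lemma reassoc_simps [simp]:
  assumes k: "k \<in> Ar C"
  shows "f \<in> Ar C \<Longrightarrow> g \<in> Ar C \<Longrightarrow> x = Dom C f \<Longrightarrow> y = Dom C g \<Longrightarrow> Cod C k = x \<Longrightarrow>
      (f \<odot> g) \<cdot> (inl x y \<cdot> k) = inl (Cod C f) (Cod C g) \<cdot> (f \<cdot> k)"
    and "f \<in> Ar C \<Longrightarrow> g \<in> Ar C \<Longrightarrow> x = Dom C f \<Longrightarrow> y = Dom C g \<Longrightarrow> Cod C k = y \<Longrightarrow>
      (f \<odot> g) \<cdot> (inr x y \<cdot> k) = inr (Cod C f) (Cod C g) \<cdot> (g \<cdot> k)"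
    and "x \<in> Ob C \<Longrightarrow> y \<in> Ob C \<Longrightarrow> z \<in> Ob C \<Longrightarrow> Cod C k = x \<Longrightarrow>
      Assoc C x y z \<cdot> (inl (x \<otimes> y) z \<cdot> (inl x y \<cdot> k)) = inl x (y \<otimes> z) \<cdot> k"
    and "x \<in> Ob C \<Longrightarrow> y \<in> Ob C \<Longrightarrow> z \<in> Ob C \<Longrightarrow> Cod C k = y \<Longrightarrow>
      Assoc C x y z \<cdot> (inl (x \<otimes> y) z \<cdot> (inr x y \<cdot> k)) = inr x (y \<otimes> z) \<cdot> (inl y z \<cdot> k)"
    and "x \<in> Ob C \<Longrightarrow> y \<in> Ob C \<Longrightarrow> z \<in> Ob C \<Longrightarrow> Cod C k = z \<Longrightarrow>
      Assoc C x y z \<cdot> (inr (x \<otimes> y) z \<cdot> k) = inr x (y \<otimes> z) \<cdot> (inr y z \<cdot> k)"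
    and "x \<in> Ob C \<Longrightarrow> Cod C k = x \<Longrightarrow> Lunit C x \<cdot> (inr (Unit C) x \<cdot> k) = k"
    and "x \<in> Ob C \<Longrightarrow> Cod C k = x \<Longrightarrow> Runit C x \<cdot> (inl x (Unit C) \<cdot> k) = k"
    and "x \<in> Ob C \<Longrightarrow> y \<in> Ob C \<Longrightarrow> Cod C k = x \<Longrightarrow> Braid C x y \<cdot> (inl x y \<cdot> k) = inr y x \<cdot> k"
    and "x \<in> Ob C \<Longrightarrow> y \<in> Ob C \<Longrightarrow> Cod C k = y \<Longrightarrow> Braid C x y \<cdot> (inr x y \<cdot> k) = inl y x \<cdot> k"
proof -
  assume "f \<in> Ar C" "g \<in> Ar C" "x = Dom C f" "y = Dom C g"
  note * = this
  show "(f \<odot> g) \<cdot> (inl x y \<cdot> k) = inl (Cod C f) (Cod C g) \<cdot> (f \<cdot> k)" if "Cod C k = x"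
    using k * that Comp_reassoc[OF TenA_inl_simp[OF *], of k] by simp
  show "(f \<odot> g) \<cdot> (inr x y \<cdot> k) = inr (Cod C f) (Cod C g) \<cdot> (g \<cdot> k)" if "Cod C k = y"
    using k * that Comp_reassoc[OF TenA_inr_simp[OF *], of k] by simp
next
  assume "x \<in> Ob C" "y \<in> Ob C" "z \<in> Ob C"
  note * = this
  show "Assoc C x y z \<cdot> (inl (x \<otimes> y) z \<cdot> (inl x y \<cdot> k)) = inl x (y \<otimes> z) \<cdot> k" if "Cod C k = x"
    using k * that Comp_reassoc[OF Assoc_inl_inl[OF *], of k] by simp
  show "Assoc C x y z \<cdot> (inl (x \<otimes> y) z \<cdot> (inr x y \<cdot> k)) = inr x (y \<otimes> z) \<cdot> (inl y z \<cdot> k)" if "Cod C k = y"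
    using k * that Comp_reassoc[OF Assoc_inl_inr[OF *], of k] by simp
qed (use k in \<open>simp_all add: Comp_reassoc[OF Assoc_inr] Comp_reassoc[OF Lunit_inr]
      Comp_reassoc[OF Runit_inl] Comp_reassoc[OF Braid_inl] Comp_reassoc[OF Braid_inr]\<close>)

lemma eq_on_injections:
  assumes "h \<in> Ar C" "h' \<in> Ar C" "Dom C h = x \<otimes> y" "Dom C h' = x \<otimes> y" "Cod C h = Cod C h'"
    and "x \<in> Ob C" "y \<in> Ob C" "h \<cdot> inl x y = h' \<cdot> inl x y" "h \<cdot> inr x y = h' \<cdot> inr x y"
  shows "h = h'"
proof -
  have "h \<in> hom C (x \<otimes> y) (Cod C h)" "h' \<in> hom C (x \<otimes> y) (Cod C h)"
    using assms by (simp_all add: hom_def)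
  moreover from this have "h \<cdot> inl x y \<in> hom C x (Cod C h)" "h \<cdot> inr x y \<in> hom C y (Cod C h)"
    using assms inl_in_hom inr_in_hom Comp_hom by blast+
  ultimately show ?thesis
    using sum[OF assms(6,7)] assms(8,9) unfolding binary_sum_def by metis
qed

lemma eq_on_injections3:
  assumes "h \<in> Ar C" "h' \<in> Ar C" "Dom C h = x \<otimes> y \<otimes> z" "Dom C h' = x \<otimes> y \<otimes> z" "Cod C h = Cod C h'"
    and "x \<in> Ob C" "y \<in> Ob C" "z \<in> Ob C"
    and "h \<cdot> (inl (x \<otimes> y) z \<cdot> inl x y) = h' \<cdot> (inl (x \<otimes> y) z \<cdot> inl x y)"
    and "h \<cdot> (inl (x \<otimes> y) z \<cdot> inr x y) = h' \<cdot> (inl (x \<otimes> y) z \<cdot> inr x y)"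
    and "h \<cdot> inr (x \<otimes> y) z = h' \<cdot> inr (x \<otimes> y) z"
  shows "h = h'"
proof (rule eq_on_injections[of _ _ "x \<otimes> y" z])
  show "h \<cdot> inl (x \<otimes> y) z = h' \<cdot> inl (x \<otimes> y) z"
    by (rule eq_on_injections[of _ _ x y]) (use assms in simp_all)
qed (use assms in simp_all)

lemma eq_from_Unit:
  assumes "f \<in> Ar C" "g \<in> Ar C" "Dom C f = Unit C" "Dom C g = Unit C" "Cod C f = Cod C g"
  shows "f = g"
  using initial assms Cod_Ob unfolding initial_object_def hom_def by blast

lemma copair_exists:
  assumes "f \<in> Ar C" "g \<in> Ar C" "Dom C f = x" "Dom C g = y" "Cod C f = z" "Cod C g = z"
  obtains h where "h \<in> Ar C" "Dom C h = x \<otimes> y" "Cod C h = z" "h \<cdot> inl x y = f" "h \<cdot> inr x y = g"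
proof -
  have "x \<in> Ob C" "y \<in> Ob C" "f \<in> hom C x z" "g \<in> hom C y z"
    using assms by (auto simp: hom_def)
  then have "\<exists>h. h \<in> hom C (x \<otimes> y) z \<and> h \<cdot> inl x y = f \<and> h \<cdot> inr x y = g"
    using sum unfolding binary_sum_def by blast
  then show thesis using that by (auto simp: hom_def)
qed

lemma inverse_arrows_unique:
  assumes "inverse_arrows C f g" "inverse_arrows C f g'"
  shows "g = g'"
proof -
  have *: "f \<in> Ar C" "g \<in> Ar C" "g' \<in> Ar C" "Dom C g = Cod C f" "Dom C g' = Cod C f"
    "Cod C g = Dom C f" "Cod C g' = Dom C f" "g \<cdot> f = Ide C (Dom C f)" "f \<cdot> g' = Ide C (Cod C f)"
    using assms by (auto simp: inverse_arrows_def hom_def)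
  then have "g = g \<cdot> (f \<cdot> g')" by simp
  also have "\<dots> = g'" using * Comp_assoc_simp[of g' f g] by simp
  finally show ?thesis .
qed

lemma inv_arrow_eq: "inverse_arrows C f g \<Longrightarrow> inv_arrow C f = g"
  unfolding inv_arrow_def by (blast intro: inverse_arrows_unique)

lemma inverse_Runit:
  assumes [simp]: "x \<in> Ob C"
  shows "inverse_arrows C (Runit C x) (inl x (Unit C))"
proof -
  have "inl x (Unit C) \<cdot> Runit C x = Ide C (x \<otimes> Unit C)"
    by (rule eq_on_injections[of _ _ x "Unit C"]) (simp_all, simp add: eq_from_Unit)
  then show ?thesis by (simp add: inverse_arrows_def hom_def)
qed

lemma inverse_Lunit:
  assumes [simp]: "x \<in> Ob C"
  shows "inverse_arrows C (Lunit C x) (inr (Unit C) x)"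
proof -
  have "inr (Unit C) x \<cdot> Lunit C x = Ide C (Unit C \<otimes> x)"
    by (rule eq_on_injections[of _ _ "Unit C" x]) (simp_all, simp add: eq_from_Unit)
  then show ?thesis by (simp add: inverse_arrows_def hom_def)
qed

lemma iso_Assoc:
  assumes [simp]: "x \<in> Ob C" "y \<in> Ob C" "z \<in> Ob C"
  shows "iso_arrow C (Assoc C x y z)"
proof -
  obtain k where k [simp]: "k \<in> Ar C" "Dom C k = y \<otimes> z" "Cod C k = x \<otimes> y \<otimes> z"
    and k' [simp]: "k \<cdot> inl y z = inl (x \<otimes> y) z \<cdot> inr x y" "k \<cdot> inr y z = inr (x \<otimes> y) z"
    by (rule copair_exists[of "inl (x \<otimes> y) z \<cdot> inr x y" "inr (x \<otimes> y) z"]) simp_all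
  obtain h where h [simp]: "h \<in> Ar C" "Dom C h = x \<otimes> (y \<otimes> z)" "Cod C h = x \<otimes> y \<otimes> z"
    and h' [simp]: "h \<cdot> inl x (y \<otimes> z) = inl (x \<otimes> y) z \<cdot> inl x y" "h \<cdot> inr x (y \<otimes> z) = k"
    by (rule copair_exists[of "inl (x \<otimes> y) z \<cdot> inl x y" k]) simp_all
  note [simp] = h'[THEN Comp_reassoc] k'[THEN Comp_reassoc]
  have "h \<cdot> Assoc C x y z = Ide C (x \<otimes> y \<otimes> z)"
    by (rule eq_on_injections3[of _ _ x y z]) simp_all
  moreover have "Assoc C x y z \<cdot> h = Ide C (x \<otimes> (y \<otimes> z))"
  proof (rule eq_on_injections[of _ _ x "y \<otimes> z"])
    show "Assoc C x y z \<cdot> h \<cdot> inr x (y \<otimes> z) = Ide C (x \<otimes> (y \<otimes> z)) \<cdot> inr x (y \<otimes> z)"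
      by (rule eq_on_injections[of _ _ y z]) simp_all
  qed simp_all
  ultimately have "inverse_arrows C (Assoc C x y z) h"
    by (simp add: inverse_arrows_def hom_def)
  then show ?thesis unfolding iso_arrow_def by blast
qed

lemma from_unit_in_hom:
  assumes "x \<in> Ob C"
  shows "from_unit C x \<in> hom C (Unit C) x"
  using theI'[of "\<lambda>f. f \<in> hom C (Unit C) x"] initial assms
  unfolding initial_object_def from_unit_def by blast

lemma from_unit_simps [simp]:
  assumes "x \<in> Ob C"
  shows "from_unit C x \<in> Ar C" "Dom C (from_unit C x) = Unit C" "Cod C (from_unit C x) = x"
  using from_unit_in_hom[OF assms] by (simp_all add: hom_def)

context
  fixes f x x' g y y'
  assumes f: "f \<in> hom C x x'" and g: "g \<in> hom C y y'"
begin

lemmas [simp] = hom_simps[OF f] hom_simps[OF g]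

lemma Braid_natural: "Braid C x' y' \<cdot> (f \<odot> g) = (g \<odot> f) \<cdot> Braid C x y"
  by (rule eq_on_injections[of _ _ x y]) simp_all

lemma TenA_Comp:
  assumes "f' \<in> hom C x' x''" "g' \<in> hom C y' y''"
  shows "(f' \<cdot> f) \<odot> (g' \<cdot> g) = (f' \<odot> g') \<cdot> (f \<odot> g)"
  supply [simp] = hom_simps(1-3,5)[OF assms(1)] hom_simps(1-3,5)[OF assms(2)]
  by (rule eq_on_injections[of _ _ x y]) simp_all

lemma Assoc_natural:
  assumes "h \<in> hom C z z'"
  shows "Assoc C x' y' z' \<cdot> (f \<odot> g \<odot> h) = (f \<odot> (g \<odot> h)) \<cdot> Assoc C x y z"
  supply [simp] = hom_simps[OF assms] by (rule eq_on_injections3[of _ _ x y z]) simp_all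

end

lemma Lunit_natural:
  assumes "f \<in> hom C x y"
  shows "Lunit C y \<cdot> (Ide C (Unit C) \<odot> f) = f \<cdot> Lunit C x"
  supply [simp] = hom_simps[OF assms]
  by (rule eq_on_injections[of _ _ "Unit C" x]) (simp_all, simp add: eq_from_Unit)

lemma Runit_natural:
  assumes "f \<in> hom C x y"
  shows "Runit C y \<cdot> (f \<odot> Ide C (Unit C)) = f \<cdot> Runit C x"
  supply [simp] = hom_simps[OF assms]
  by (rule eq_on_injections[of _ _ x "Unit C"]) (simp_all, simp add: eq_from_Unit)

context
  fixes x y
  assumes [simp]: "x \<in> Ob C" "y \<in> Ob C"
begin

lemma TenA_Ide: "Ide C x \<odot> Ide C y = Ide C (x \<otimes> y)"
  by (rule eq_on_injections[of _ _ x y]) simp_all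

lemma Braid_Braid: "Braid C y x \<cdot> Braid C x y = Ide C (x \<otimes> y)"
  by (rule eq_on_injections[of _ _ x y]) simp_all

lemma triangle: "(Ide C x \<odot> Lunit C y) \<cdot> Assoc C x (Unit C) y = Runit C x \<odot> Ide C y"
  by (rule eq_on_injections3[of _ _ x "Unit C" y]) (simp_all, simp add: eq_from_Unit)

lemma inl_tensor: "inl_tensor C x y = inl x y"
  and inr_tensor: "inr_tensor C x y = inr x y"
  unfolding inl_tensor_def inr_tensor_def
  by (simp_all add: inv_arrow_eq[OF inverse_Runit] inv_arrow_eq[OF inverse_Lunit])

lemma hexagon:
  assumes [simp]: "z \<in> Ob C"
  shows "Assoc C y z x \<cdot> Braid C x (y \<otimes> z) \<cdot> Assoc C x y z =
      (Ide C y \<odot> Braid C x z) \<cdot> Assoc C y x z \<cdot> (Braid C x y \<odot> Ide C z)"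
  by (rule eq_on_injections3[of _ _ x y z]) simp_all

lemma pentagon:
  assumes [simp]: "w \<in> Ob C" "z \<in> Ob C"
  shows "Assoc C w x (y \<otimes> z) \<cdot> Assoc C (w \<otimes> x) y z =
      (Ide C w \<odot> Assoc C x y z) \<cdot> Assoc C w (x \<otimes> y) z \<cdot> (Assoc C w x y \<odot> Ide C z)"
    (is "?l = ?r")
proof (rule eq_on_injections3[of _ _ "w \<otimes> x" y z])
  show "?l \<cdot> (inl (w \<otimes> x \<otimes> y) z \<cdot> inl (w \<otimes> x) y) = ?r \<cdot> (inl (w \<otimes> x \<otimes> y) z \<cdot> inl (w \<otimes> x) y)"
    by (rule eq_on_injections[of _ _ w x]) simp_all
qed simp_all

end

theorem cocartesian: "cocartesian_monoidal_category C"
proof (intro cocartesian_monoidal_category.intro symmetric_monoidal_category.intro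
    symmetric_monoidal_category_axioms.intro cocartesian_monoidal_category_axioms.intro)
  show "category C" ..
  show "initial_object C (Unit C)" by (rule initial)
  show "binary_sum C x y (x \<otimes> y) (inl_tensor C x y) (inr_tensor C x y)"
    if "x \<in> Ob C" "y \<in> Ob C" for x y
    using that by (simp add: inl_tensor inr_tensor sum)
  show "iso_arrow C (Lunit C x)" "iso_arrow C (Runit C x)" if "x \<in> Ob C" for x
    using inverse_Lunit[OF that] inverse_Runit[OF that] unfolding iso_arrow_def by blast+
  show "(f' \<cdot> f) \<odot> (g' \<cdot> g) = (f' \<odot> g') \<cdot> (f \<odot> g)"
    if "f \<in> hom C x x'" "f' \<in> hom C x' x''" "g \<in> hom C y y'" "g' \<in> hom C y' y''"
    for f f' g g' x x' x'' y y' y''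
    by (rule TenA_Comp[OF that(1,3,2,4)])
  show "Assoc C w x (y \<otimes> z) \<cdot> Assoc C (w \<otimes> x) y z =
      (Ide C w \<odot> Assoc C x y z) \<cdot> Assoc C w (x \<otimes> y) z \<cdot> (Assoc C w x y \<odot> Ide C z)"
    if "w \<in> Ob C" "x \<in> Ob C" "y \<in> Ob C" "z \<in> Ob C" for w x y z
    by (rule pentagon[OF that(2,3,1,4)])
qed (fact TenO_closed TenA_in_hom TenA_Ide Unit_closed Assoc_in_hom iso_Assoc Assoc_natural
    Lunit_in_hom Lunit_natural Runit_in_hom Runit_natural Braid_in_hom Braid_natural Braid_Braid
    triangle hexagon)+

end


section \<open>Generalised elements\<close>

context symmetric_multicategory
begin

definition labelled :: "'o \<Rightarrow> (nat list \<times> 'a) set" where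
  "labelled A = {r. snd r \<in> Arr M \<and> trg M (snd r) = A \<and> length (fst r) = length (src M (snd r))}"

text \<open>The labels need not be distinct, so that elements can be substituted into arrows freely.\<close>

definition elt :: "nat list \<times> 'a \<Rightarrow> (nat list \<times> 'a) set" where
  "elt r = {(permute_list p (fst r), act M p (snd r)) | p. p permutes {..<length (fst r)}}"

definition El :: "'o \<Rightarrow> (nat list \<times> 'a) set set" where
  "El A = elt ` labelled A"

abbreviation Els :: "(nat list \<times> 'a) set list \<Rightarrow> 'o list \<Rightarrow> bool" where
  "Els \<equiv> list_all2 (\<lambda>a A. a \<in> El A)"

definition ap :: "'a \<Rightarrow> (nat list \<times> 'a) set list \<Rightarrow> (nat list \<times> 'a) set" where
  "ap f as = (let rs = map (\<lambda>a. SOME r. r \<in> a) as in elt (concat (map fst rs), cmp M f (map snd rs)))"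

lemma elt_self:
  assumes "r \<in> labelled A"
  shows "r \<in> elt r"
proof -
  have "r = (permute_list id (fst r), act M id (snd r))"
    using assms by (simp add: labelled_def act_id)
  then show ?thesis unfolding elt_def using permutes_id by blast
qed

lemma elt_eqI:
  assumes r: "r \<in> labelled A" and "r' \<in> elt r"
  shows "elt r' = elt r"
proof -
  obtain xs f where r_eq: "r = (xs, f)" by fastforce
  then have f: "f \<in> Arr M" "length (src M f) = length xs" using r by (auto simp: labelled_def)
  obtain p where p: "p permutes {..<length xs}" and r': "r' = (permute_list p xs, act M p f)"
    using assms(2) by (auto simp: elt_def r_eq)
  have comp: "(permute_list q (permute_list p xs), act M q (act M p f)) = (permute_list (p \<circ> q) xs, act M (p \<circ> q) f)"
    if "q permutes {..<length xs}" for q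
    using that p f by (simp add: act_act permute_list_compose)
  have "elt r' \<subseteq> elt r"
    unfolding r' r_eq elt_def using comp permutes_compose[OF _ p] by auto
  moreover have "elt r \<subseteq> elt r'"
  proof
    fix s assume "s \<in> elt r"
    then obtain q where q: "q permutes {..<length xs}" "s = (permute_list q xs, act M q f)"
      by (auto simp: elt_def r_eq)
    have "inv p \<circ> q permutes {..<length xs}"
      using permutes_compose[OF q(1) permutes_inv[OF p]] .
    moreover have "p \<circ> (inv p \<circ> q) = q"
      using permutes_inv_o(1)[OF p] by (simp add: comp_assoc[symmetric])
    ultimately have "s = (permute_list (inv p \<circ> q) (permute_list p xs), act M (inv p \<circ> q) (act M p f))"
      using comp[of "inv p \<circ> q"] q(2) by simp
    then show "s \<in> elt r'"
      unfolding r' elt_def using \<open>inv p \<circ> q permutes _\<close> by auto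
  qed
  ultimately show ?thesis by blast
qed

lemma Els_representatives:
  assumes "Els as As"
  obtains rs where "as = map elt rs" "list_all2 (\<lambda>r A. r \<in> labelled A) rs As"
proof -
  have "\<exists>rs. as = map elt rs \<and> list_all2 (\<lambda>r A. r \<in> labelled A) rs As"
    using assms
  proof (induction as As rule: list_all2_induct)
    case Nil then show ?case by simp
  next
    case (Cons a as A As)
    then obtain r rs where "a = elt r" "r \<in> labelled A" "as = map elt rs"
      "list_all2 (\<lambda>r A. r \<in> labelled A) rs As"
      unfolding El_def by blast
    then show ?case by (intro exI[of _ "r # rs"]) simp
  qed
  then show thesis using that by blast
qed

lemma arrows_of_representatives:
  assumes "list_all2 (\<lambda>r A. r \<in> labelled A) rs As"
  shows "set (map snd rs) \<subseteq> Arr M" "map (trg M) (map snd rs) = As"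
    "map (\<lambda>g. length (src M g)) (map snd rs) = map length (map fst rs)"
  using assms by (induction rs As rule: list_all2_induct) (simp_all add: labelled_def)

lemma composable_representatives:
  "f \<in> Arr M \<Longrightarrow> list_all2 (\<lambda>r A. r \<in> labelled A) rs (src M f) \<Longrightarrow> composable M f (map snd rs)"
  unfolding composable_def using arrows_of_representatives by blast

lemma cmp_labelled:
  assumes "f \<in> Arr M" "list_all2 (\<lambda>r A. r \<in> labelled A) rs (src M f)"
  shows "(concat (map fst rs), cmp M f (map snd rs)) \<in> labelled (trg M f)"
proof -
  have "length (concat (map fst rs)) = length (concat (map (src M) (map snd rs)))"
    using arg_cong[OF arrows_of_representatives(3)[OF assms(2)], of sum_list]
    unfolding length_concat by (simp only: map_map comp_def)
  then show ?thesis
    using cmp_mhom[OF composable_representatives[OF assms]] by (simp add: labelled_def mhom_def)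
qed

lemma ap_elt:
  assumes f: "f \<in> Arr M" and rs: "list_all2 (\<lambda>r A. r \<in> labelled A) rs (src M f)"
  shows "ap f (map elt rs) = elt (concat (map fst rs), cmp M f (map snd rs))"
proof -
  define rs' where "rs' = map (\<lambda>r. SOME r'. r' \<in> elt r) rs"
  have "\<exists>p. p permutes {..<length (fst (rs ! k))} \<and> rs' ! k = (permute_list p (fst (rs ! k)), act M p (snd (rs ! k)))"
    if "k < length rs" for k
  proof -
    have "rs ! k \<in> labelled (src M f ! k)" using rs that by (simp add: list_all2_conv_all_nth)
    then have "rs' ! k \<in> elt (rs ! k)"
      unfolding rs'_def using that someI[of "\<lambda>r'. r' \<in> elt (rs ! k)", OF elt_self] by simp
    then show ?thesis by (auto simp: elt_def)
  qed
  then obtain q where q: "\<And>k. k < length rs \<Longrightarrow> q k permutes {..<length (fst (rs ! k))} \<and>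
      rs' ! k = (permute_list (q k) (fst (rs ! k)), act M (q k) (snd (rs ! k)))"
    by metis
  define ps where "ps = map q [0..<length rs]"
  have 1: "map fst rs' = map2 permute_list ps (map fst rs)" "map snd rs' = map2 (act M) ps (map snd rs)"
    using q by (auto simp: ps_def rs'_def intro!: nth_equalityI)
  have "length (src M (snd (rs ! k))) = length (fst (rs ! k))" if "k < length rs" for k
    using rs that by (simp add: list_all2_conv_all_nth labelled_def)
  then have "list_all2 (\<lambda>p g. p permutes {..<length (src M g)}) ps (map snd rs)"
    using q by (simp add: list_all2_conv_all_nth ps_def)
  note 2 = cmp_act_right[OF composable_representatives[OF f rs] this]
  have ps: "length ps = length (map fst rs)" "\<And>k. k < length (map fst rs) \<Longrightarrow> ps ! k permutes {..<length (map fst rs ! k)}"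
    using q by (simp_all add: ps_def)
  let ?p = "sum_perm ps (map length (map fst rs))"
  have "?p permutes {..<length (concat (map fst rs))}"
    using sum_perm_permutes[of ps "map length (map fst rs)"] ps by (simp add: length_concat)
  moreover have "concat (map fst rs') = permute_list ?p (concat (map fst rs))"
    using permute_list_sum_perm[OF ps] by (simp add: 1)
  moreover have "cmp M f (map snd rs') = act M ?p (cmp M f (map snd rs))"
    using 2 by (simp only: 1 arrows_of_representatives(3)[OF rs])
  ultimately have "(concat (map fst rs'), cmp M f (map snd rs')) \<in> elt (concat (map fst rs), cmp M f (map snd rs))"
    by (auto simp: elt_def)
  from elt_eqI[OF cmp_labelled[OF f rs] this] show ?thesis
    by (simp add: ap_def rs'_def Let_def comp_def)
qed

lemma ap_El [simp]:
  assumes "f \<in> Arr M" "Els as (src M f)" "trg M f = B"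
  shows "ap f as \<in> El B"
proof -
  obtain rs where "as = map elt rs" "list_all2 (\<lambda>r A. r \<in> labelled A) rs (src M f)"
    using Els_representatives[OF assms(2)] .
  then show ?thesis using cmp_labelled[OF assms(1)] assms by (auto simp: ap_elt El_def)
qed

lemma ap_act:
  assumes f: "f \<in> Arr M" and "Els as (src M f)" and p: "p permutes {..<length (src M f)}"
  shows "ap (act M p f) (permute_list p as) = ap f as"
proof -
  obtain rs where as: "as = map elt rs" and rs: "list_all2 (\<lambda>r A. r \<in> labelled A) rs (src M f)"
    using Els_representatives[OF assms(2)] .
  have len: "length (src M f) = length rs" using rs by (simp add: list_all2_lengthD)
  note p' = p[unfolded len]
  have pf: "act M p f \<in> Arr M" "src M (act M p f) = permute_list p (src M f)"
    using act_mhom[OF f p] by (simp_all add: mhom_def)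
  have prs: "list_all2 (\<lambda>r A. r \<in> labelled A) (permute_list p rs) (src M (act M p f))"
    using rs p' by (simp add: pf list_all2_permute_list_iff)
  let ?q = "block_perm p (map length (map fst rs))"
  have "ap (act M p f) (permute_list p as)
      = elt (concat (permute_list p (map fst rs)), cmp M (act M p f) (permute_list p (map snd rs)))"
    using ap_elt[OF pf(1) prs] p' by (simp add: as permute_list_map)
  also have "concat (permute_list p (map fst rs)) = permute_list ?q (concat (map fst rs))"
    using permute_list_block_perm[of p "map fst rs"] p' by simp
  also have "cmp M (act M p f) (permute_list p (map snd rs)) = act M ?q (cmp M f (map snd rs))"
    using cmp_act_left[OF composable_representatives[OF f rs], of p] p'
    unfolding arrows_of_representatives(3)[OF rs] by simp
  also have "elt (permute_list ?q (concat (map fst rs)), act M ?q (cmp M f (map snd rs)))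
      = elt (concat (map fst rs), cmp M f (map snd rs))"
  proof (rule elt_eqI[OF cmp_labelled[OF f rs]])
    have "?q permutes {..<length (concat (map fst rs))}"
      using block_perm_permutes[of p "map length (map fst rs)"] p' by (simp add: length_concat)
    then show "(permute_list ?q (concat (map fst rs)), act M ?q (cmp M f (map snd rs)))
        \<in> elt (concat (map fst rs), cmp M f (map snd rs))"
      by (auto simp: elt_def)
  qed
  also have "\<dots> = ap f as" by (simp add: as ap_elt[OF f rs])
  finally show ?thesis .
qed

lemma Els_concat_split:
  assumes "Els as (concat (map (src M) gs))"
  obtains ass where "as = concat ass" "list_all2 (\<lambda>g as. Els as (src M g)) gs ass"
  using assms
proof (induction gs arbitrary: as thesis)
  case Nil then show ?case by simp
next
  case (Cons g gs)
  from Cons.prems(2) obtain bs cs where "as = bs @ cs" "Els bs (src M g)" "Els cs (concat (map (src M) gs))"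
    by (auto simp: list_all2_append2)
  moreover obtain css where "cs = concat css" "list_all2 (\<lambda>g as. Els as (src M g)) gs css"
    using Cons.IH[OF _ calculation(3)] by blast
  ultimately show ?case using Cons.prems(1)[of "bs # css"] by simp
qed

lemma ap_cmp:
  assumes fgs: "composable M f gs" and "list_all2 (\<lambda>g as. Els as (src M g)) gs ass"
  shows "ap (cmp M f gs) (concat ass) = ap f (map2 ap gs ass)"
proof -
  have "\<exists>rss. ass = map (map elt) rss \<and> list_all2 (\<lambda>g rs. list_all2 (\<lambda>r A. r \<in> labelled A) rs (src M g)) gs rss"
    using assms(2)
  proof (induction gs ass rule: list_all2_induct)
    case Nil then show ?case by simp
  next
    case (Cons g gs as ass)
    then obtain rss where "ass = map (map elt) rss"
      "list_all2 (\<lambda>g rs. list_all2 (\<lambda>r A. r \<in> labelled A) rs (src M g)) gs rss" by blast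
    moreover obtain rs where "as = map elt rs" "list_all2 (\<lambda>r A. r \<in> labelled A) rs (src M g)"
      using Els_representatives[OF Cons.hyps(1)] .
    ultimately show ?case by (intro exI[of _ "rs # rss"]) simp
  qed
  then obtain rss where ass: "ass = map (map elt) rss"
    and rss: "list_all2 (\<lambda>g rs. list_all2 (\<lambda>r A. r \<in> labelled A) rs (src M g)) gs rss" by blast
  have f: "f \<in> Arr M" and gs: "set gs \<subseteq> Arr M" and srcf: "src M f = map (trg M) gs"
    using fgs by (simp_all add: composable_def)
  have fg: "cmp M f gs \<in> Arr M" "src M (cmp M f gs) = concat (map (src M) gs)"
    using cmp_mhom[OF fgs] by (simp_all add: mhom_def)
  let ?h = "\<lambda>g rs. (concat (map fst rs), cmp M g (map snd rs))"
  have 1: "list_all2 (\<lambda>r A. r \<in> labelled A) (concat rss) (src M (cmp M f gs))"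
    unfolding fg using rss by (induction gs rss rule: list_all2_induct) (simp_all add: list_all2_appendI)
  have 2: "list_all2 (\<lambda>r A. r \<in> labelled A) (map2 ?h gs rss) (src M f)"
    unfolding srcf using rss gs
    by (induction gs rss rule: list_all2_induct) (simp_all add: cmp_labelled)
  have 3: "map2 ap gs ass = map elt (map2 ?h gs rss)"
    unfolding ass using rss gs
    by (induction gs rss rule: list_all2_induct) (simp_all add: ap_elt)
  have 4: "list_all2 (composable M) gs (map (map snd) rss)"
    using rss gs by (induction gs rss rule: list_all2_induct) (simp_all add: composable_representatives)
  have 5: "concat (map fst (map2 ?h gs rss)) = concat (map fst (concat rss))"
    "map snd (map2 ?h gs rss) = map2 (cmp M) gs (map (map snd) rss)"
    using rss by (induction gs rss rule: list_all2_induct) simp_all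
  have "ap (cmp M f gs) (concat ass) = elt (concat (map fst (concat rss)), cmp M (cmp M f gs) (map snd (concat rss)))"
    using ap_elt[OF fg(1) 1] by (simp add: ass map_concat)
  also have "\<dots> = elt (concat (map fst (map2 ?h gs rss)), cmp M f (map snd (map2 ?h gs rss)))"
    using cmp_assoc[OF fgs 4] by (simp only: 5) (simp add: map_concat)
  also have "\<dots> = ap f (map2 ap gs ass)"
    by (simp only: 3 ap_elt[OF f 2])
  finally show ?thesis .
qed

lemma ap_idn [simp]:
  assumes "a \<in> El A"
  shows "ap (idn M A) [a] = a"
proof -
  obtain xs f where a: "a = elt (xs, f)" and r: "(xs, f) \<in> labelled A" using assms by (auto simp: El_def)
  then have f: "f \<in> Arr M" "trg M f = A" by (auto simp: labelled_def)
  have "idn M A \<in> Arr M" "src M (idn M A) = [A]"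
    using idn_mhom[of A] trg_Obj f by (auto simp: mhom_def)
  then have "ap (idn M A) (map elt [(xs, f)]) = elt (xs, cmp M (idn M A) [f])"
    using r by (subst ap_elt) simp_all
  then show ?thesis using cmp_idn_left[OF f(1)] f a by simp
qed

lemma elt_inject_distinct:
  assumes "(xs, f) \<in> labelled A" "(xs, g) \<in> labelled A" "elt (xs, f) = elt (xs, g)" "distinct xs"
  shows "f = g"
proof -
  have "(xs, f) \<in> elt (xs, g)" using elt_self[OF assms(1)] assms(3) by simp
  then obtain p where p: "p permutes {..<length xs}" "xs = permute_list p xs" "f = act M p g"
    by (auto simp: elt_def)
  have "p i = i" for i
  proof (cases "i < length xs")
    case True
    then have "xs ! i = xs ! p i" using p permute_list_nth[OF p(1) True] by simp
    moreover have "p i < length xs" using True permutes_in_image[OF p(1), of i] by simp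
    ultimately show ?thesis using True assms(4) nth_eq_iff_index_eq by metis
  next
    case False then show ?thesis using permutes_not_in[OF p(1)] by simp
  qed
  then have "p = id" by auto
  then show ?thesis using p(3) assms(2) by (simp add: act_id labelled_def)
qed

lemma arrow_eqI:
  assumes f: "f \<in> mhom M As B" and g: "g \<in> mhom M As B"
    and eq: "\<And>as. Els as As \<Longrightarrow> ap f as = ap g as"
  shows "f = g"
proof -
  let ?rs = "map (\<lambda>i. ([i], idn M (As ! i))) [0..<length As]"
  have "As ! i \<in> Obj M" if "i < length As" for i
    using f src_Obj[of f] that by (auto simp: mhom_def)
  then have rs: "list_all2 (\<lambda>r A. r \<in> labelled A) ?rs As"
    using idn_mhom by (auto simp: list_all2_conv_all_nth labelled_def mhom_def)
  have "Els (map elt ?rs) As"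
    using rs by (auto simp: list_all2_conv_all_nth El_def)
  from eq[OF this] have "elt (concat (map fst ?rs), cmp M f (map snd ?rs)) = elt (concat (map fst ?rs), cmp M g (map snd ?rs))"
    using ap_elt[of f ?rs] ap_elt[of g ?rs] f g rs by (simp add: mhom_def)
  moreover have "map snd ?rs = map (idn M) As" by (auto intro: nth_equalityI)
  moreover have fst: "concat (map fst ?rs) = [0..<length As]" by (simp add: comp_def)
  moreover have "cmp M f (map (idn M) As) = f" "cmp M g (map (idn M) As) = g"
    using f g cmp_idn_right[of f] cmp_idn_right[of g] by (auto simp: mhom_def)
  ultimately have "elt ([0..<length As], f) = elt ([0..<length As], g)" by (simp only:)
  then show ?thesis
    by (rule elt_inject_distinct[rotated 2, of _ _ _ B]) (use f g in \<open>simp_all add: labelled_def mhom_def\<close>)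
qed

lemma arrow_eqI_universal:
  assumes "representable M" and vs: "\<forall>v \<in> set vs. preuniversal M v"
    and f: "f \<in> mhom M (map (trg M) vs) B" and g: "g \<in> mhom M (map (trg M) vs) B"
    and eq: "\<And>ass. list_all2 (\<lambda>v as. Els as (src M v)) vs ass \<Longrightarrow> ap f (map2 ap vs ass) = ap g (map2 ap vs ass)"
  shows "f = g"
proof -
  have "set vs \<subseteq> Arr M" using vs by (auto simp: preuniversal_def)
  then have comp: "composable M f vs" "composable M g vs" using f g by (simp_all add: composable_def mhom_def)
  then have hom: "cmp M f vs \<in> mhom M (concat (map (src M) vs)) B" "cmp M g vs \<in> mhom M (concat (map (src M) vs)) B"
    using cmp_mhom[OF comp(1)] cmp_mhom[OF comp(2)] f g by (simp_all add: mhom_def)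
  have "cmp M f vs = cmp M g vs"
  proof (rule arrow_eqI[OF hom])
    fix as assume "Els as (concat (map (src M) vs))"
    then obtain ass where "as = concat ass" "list_all2 (\<lambda>v as. Els as (src M v)) vs ass"
      by (rule Els_concat_split)
    then show "ap (cmp M f vs) as = ap (cmp M g vs) as"
      using ap_cmp[OF comp(1)] ap_cmp[OF comp(2)] eq by simp
  qed
  with f g show ?thesis
    using ex1_factor[OF assms(1) vs hom(1)] by metis
qed

end

context symmetric_multicategory
begin

lemma idn_simps [simp]:
  assumes "A \<in> Obj M"
  shows "idn M A \<in> Arr M" "src M (idn M A) = [A]" "trg M (idn M A) = A"
  using idn_mhom[OF assms] by (simp_all add: mhom_def)

lemma cmp1_simps [simp]:
  assumes "f \<in> Arr M" "g \<in> Arr M" "src M f = [trg M g]"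
  shows "cmp M f [g] \<in> Arr M" "src M (cmp M f [g]) = src M g" "trg M (cmp M f [g]) = trg M f"
    "Els as (src M g) \<Longrightarrow> ap (cmp M f [g]) as = ap f [ap g as]"
proof -
  have *: "composable M f [g]" using assms by (simp add: composable_def)
  show "cmp M f [g] \<in> Arr M" "src M (cmp M f [g]) = src M g" "trg M (cmp M f [g]) = trg M f"
    using cmp_mhom[OF *] by (simp_all add: mhom_def)
  show "Els as (src M g) \<Longrightarrow> ap (cmp M f [g]) as = ap f [ap g as]"
    using ap_cmp[OF *, of "[as]"] by simp
qed

lemma cmp2_simps [simp]:
  assumes "f \<in> Arr M" "g \<in> Arr M" "h \<in> Arr M" "src M f = [trg M g, trg M h]"
  shows "cmp M f [g, h] \<in> Arr M" "src M (cmp M f [g, h]) = src M g @ src M h"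
    "trg M (cmp M f [g, h]) = trg M f"
    "Els as (src M g @ src M h) \<Longrightarrow>
      ap (cmp M f [g, h]) as = ap f [ap g (take (length (src M g)) as), ap h (drop (length (src M g)) as)]"
proof -
  have *: "composable M f [g, h]" using assms by (simp add: composable_def)
  show "cmp M f [g, h] \<in> Arr M" "src M (cmp M f [g, h]) = src M g @ src M h"
    "trg M (cmp M f [g, h]) = trg M f"
    using cmp_mhom[OF *] by (simp_all add: mhom_def)
  assume "Els as (src M g @ src M h)"
  then obtain bs cs where "as = bs @ cs" "Els bs (src M g)" "Els cs (src M h)"
    by (auto simp: list_all2_append2)
  then show "ap (cmp M f [g, h]) as = ap f [ap g (take (length (src M g)) as), ap h (drop (length (src M g)) as)]"
    using ap_cmp[OF *, of "[bs, cs]"] by (simp add: list_all2_lengthD[symmetric])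
qed

lemma act_swap [simp]:
  assumes "f \<in> Arr M" "src M f = [A, B]"
  shows "act M (transpose 0 (Suc 0)) f \<in> Arr M" "src M (act M (transpose 0 (Suc 0)) f) = [B, A]"
    "trg M (act M (transpose 0 (Suc 0)) f) = trg M f"
    "a \<in> El A \<Longrightarrow> b \<in> El B \<Longrightarrow> ap (act M (transpose 0 (Suc 0)) f) [b, a] = ap f [a, b]"
proof -
  have p: "transpose 0 (Suc 0) permutes {..<length (src M f)}"
    by (rule permutes_swap_id) (simp_all add: assms)
  have list: "permute_list (transpose 0 (Suc 0)) [x, y] = [y, x]" for x y :: 'z
    by (simp add: permute_list_def transpose_def)
  show "act M (transpose 0 (Suc 0)) f \<in> Arr M" "src M (act M (transpose 0 (Suc 0)) f) = [B, A]"
    "trg M (act M (transpose 0 (Suc 0)) f) = trg M f"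
    using act_mhom[OF assms(1) p] by (simp_all add: mhom_def list assms)
  show "a \<in> El A \<Longrightarrow> b \<in> El B \<Longrightarrow> ap (act M (transpose 0 (Suc 0)) f) [b, a] = ap f [a, b]"
    using ap_act[OF assms(1) _ p, of "[a, b]"] by (simp add: list assms)
qed

lemma act_middle_swap [simp]:
  assumes "f \<in> Arr M" "src M f = [A, B, C, D]"
  shows "act M (transpose (Suc 0) 2) f \<in> Arr M" "src M (act M (transpose (Suc 0) 2) f) = [A, C, B, D]"
    "trg M (act M (transpose (Suc 0) 2) f) = trg M f"
    "a \<in> El A \<Longrightarrow> b \<in> El B \<Longrightarrow> c \<in> El C \<Longrightarrow> d \<in> El D \<Longrightarrow>
      ap (act M (transpose (Suc 0) 2) f) [a, c, b, d] = ap f [a, b, c, d]"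
proof -
  have p: "transpose (Suc 0) 2 permutes {..<length (src M f)}"
    by (rule permutes_swap_id) (simp_all add: assms)
  have list: "permute_list (transpose (Suc 0) 2) [w, x, y, z] = [w, y, x, z]" for w x y z :: 'z
    by (simp add: permute_list_def transpose_def upt_rec numeral_eq_Suc)
  show "act M (transpose (Suc 0) 2) f \<in> Arr M" "src M (act M (transpose (Suc 0) 2) f) = [A, C, B, D]"
    "trg M (act M (transpose (Suc 0) 2) f) = trg M f"
    using act_mhom[OF assms(1) p] by (simp_all add: mhom_def list assms)
  show "a \<in> El A \<Longrightarrow> b \<in> El B \<Longrightarrow> c \<in> El C \<Longrightarrow> d \<in> El D \<Longrightarrow>
      ap (act M (transpose (Suc 0) 2) f) [a, c, b, d] = ap f [a, b, c, d]"
    using ap_act[OF assms(1) _ p, of "[a, b, c, d]"] by (simp add: list assms)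
qed

end


section \<open>Commutative monoids in terms of elements\<close>

context symmetric_multicategory
begin

definition zero :: "('o, 'a) cmon \<Rightarrow> (nat list \<times> 'a) set" where
  "zero X = ap (mul0 X) []"

definition plus :: "('o, 'a) cmon \<Rightarrow> (nat list \<times> 'a) set \<Rightarrow> (nat list \<times> 'a) set \<Rightarrow> (nat list \<times> 'a) set" where
  "plus X a b = ap (mul2 X) [a, b]"

abbreviation mon :: "('o, 'a) cmon \<Rightarrow> bool" where
  "mon \<equiv> commutative_monoid M"

lemma mon_simps [simp]:
  assumes "mon X"
  shows "carr X \<in> Obj M"
    "mul0 X \<in> Arr M" "src M (mul0 X) = []" "trg M (mul0 X) = carr X"
    "mul2 X \<in> Arr M" "src M (mul2 X) = [carr X, carr X]" "trg M (mul2 X) = carr X"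
  using assms by (simp_all add: commutative_monoid_def mhom_def)

lemma zero_El [simp]: "mon X \<Longrightarrow> zero X \<in> El (carr X)"
  by (simp add: zero_def)

lemma plus_El [simp]: "mon X \<Longrightarrow> a \<in> El (carr X) \<Longrightarrow> b \<in> El (carr X) \<Longrightarrow> plus X a b \<in> El (carr X)"
  by (simp add: plus_def)

lemma mon_laws:
  assumes X [simp]: "mon X" and a [simp]: "a \<in> El (carr X)"
  shows plus_zero_left [simp]: "plus X (zero X) a = a"
    and plus_zero_right [simp]: "plus X a (zero X) = a"
    and plus_assoc: "b \<in> El (carr X) \<Longrightarrow> c \<in> El (carr X) \<Longrightarrow> plus X (plus X a b) c = plus X a (plus X b c)"
    and plus_commute: "b \<in> El (carr X) \<Longrightarrow> plus X a b = plus X b a"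
proof -
  note laws = X[unfolded commutative_monoid_def]
  have "ap (cmp M (mul2 X) [mul0 X, idn M (carr X)]) [a] = ap (idn M (carr X)) [a]"
    using laws by simp
  then show "plus X (zero X) a = a" by (simp add: plus_def zero_def)
  have "ap (cmp M (mul2 X) [idn M (carr X), mul0 X]) [a] = ap (idn M (carr X)) [a]"
    using laws by simp
  then show "plus X a (zero X) = a" by (simp add: plus_def zero_def)
  assume b [simp]: "b \<in> El (carr X)"
  have "ap (act M (transpose 0 1) (mul2 X)) [b, a] = ap (mul2 X) [b, a]"
    using laws by simp
  then show "plus X a b = plus X b a" by (simp add: plus_def)
  assume c [simp]: "c \<in> El (carr X)"
  have "ap (cmp M (mul2 X) [mul2 X, idn M (carr X)]) [a, b, c] = ap (cmp M (mul2 X) [idn M (carr X), mul2 X]) [a, b, c]"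
    using laws by simp
  then show "plus X (plus X a b) c = plus X a (plus X b c)" by (simp add: plus_def)
qed

lemma preuniversal_Arr [simp]: "preuniversal M v \<Longrightarrow> v \<in> Arr M"
  by (simp add: preuniversal_def)

lemma preuniversal_idn [simp]:
  assumes [simp]: "A \<in> Obj M"
  shows "preuniversal M (idn M A)"
proof -
  have "bij_betw (\<lambda>f. cmp M f [idn M A]) (mhom M [A] B) (mhom M [A] B)" for B
  proof (subst bij_betw_cong)
    show "cmp M f [idn M A] = id f" if "f \<in> mhom M [A] B" for f
      using that cmp_idn_right[of f] by (auto simp: mhom_def)
  qed (rule bij_betw_id)
  then show ?thesis by (simp add: preuniversal_def)
qed

lemma cmon_morphism_simps:
  assumes "cmon_morphism M X Y f" and [simp]: "mon X" "mon Y"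
  shows cmon_morphism_mhom: "f \<in> Arr M" "src M f = [carr X]" "trg M f = carr Y"
    and cmon_morphism_El: "a \<in> El (carr X) \<Longrightarrow> ap f [a] \<in> El (carr Y)"
    and cmon_morphism_zero: "ap f [zero X] = zero Y"
    and cmon_morphism_plus: "a \<in> El (carr X) \<Longrightarrow> b \<in> El (carr X) \<Longrightarrow>
      ap f [plus X a b] = plus Y (ap f [a]) (ap f [b])"
proof -
  note f = assms(1)[unfolded cmon_morphism_def]
  show [simp]: "f \<in> Arr M" "src M f = [carr X]" "trg M f = carr Y"
    using f by (simp_all add: mhom_def)
  show "a \<in> El (carr X) \<Longrightarrow> ap f [a] \<in> El (carr Y)" by simp
  have "ap (cmp M f [mul0 X]) [] = ap (mul0 Y) []" using f by simp
  then show "ap f [zero X] = zero Y" by (simp add: zero_def)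
  assume [simp]: "a \<in> El (carr X)" "b \<in> El (carr X)"
  have "ap (cmp M f [mul2 X]) [a, b] = ap (cmp M (mul2 Y) [f, f]) [a, b]" using f by simp
  then show "ap f [plus X a b] = plus Y (ap f [a]) (ap f [b])" by (simp add: plus_def)
qed

end

locale representable_tensor = symmetric_multicategory M + tensor_choice M t e
  for M :: "('o, 'a, 'm) multicat_scheme" (structure) and t e +
  assumes representable: "representable M"
begin

lemma preuniversal_cmp2 [simp]:
  assumes "preuniversal M u" "preuniversal M v" "preuniversal M w" "src M u = [trg M v, trg M w]"
  shows "preuniversal M (cmp M u [v, w])"
  using representable assms unfolding representable_def by (auto simp: composable_def)

lemma factor1 [simp]:
  assumes u: "preuniversal M u" and f: "f \<in> Arr M" "src M f = src M u"
  shows "factor M [u] f \<in> Arr M" "src M (factor M [u] f) = [trg M u]" "trg M (factor M [u] f) = trg M f"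
    "Els as (src M u) \<Longrightarrow> ap (factor M [u] f) [ap u as] = ap f as"
proof -
  have *: "factor M [u] f \<in> mhom M [trg M u] (trg M f)" "cmp M (factor M [u] f) [u] = f"
    using factor[OF representable, of "[u]" f "trg M f"] assms by (simp_all add: mhom_def)
  show "factor M [u] f \<in> Arr M" "src M (factor M [u] f) = [trg M u]" "trg M (factor M [u] f) = trg M f"
    using * by (simp_all add: mhom_def)
  then show "Els as (src M u) \<Longrightarrow> ap (factor M [u] f) [ap u as] = ap f as"
    using cmp1_simps(4)[of "factor M [u] f" u as] u *(2) by simp
qed

lemma factor2 [simp]:
  assumes u: "preuniversal M u" "preuniversal M v" and f: "f \<in> Arr M" "src M f = src M u @ src M v"
  shows "factor M [u, v] f \<in> Arr M" "src M (factor M [u, v] f) = [trg M u, trg M v]"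
    "trg M (factor M [u, v] f) = trg M f"
    "Els as (src M u) \<Longrightarrow> Els bs (src M v) \<Longrightarrow> ap (factor M [u, v] f) [ap u as, ap v bs] = ap f (as @ bs)"
proof -
  have *: "factor M [u, v] f \<in> mhom M [trg M u, trg M v] (trg M f)" "cmp M (factor M [u, v] f) [u, v] = f"
    using factor[OF representable, of "[u, v]" f "trg M f"] assms by (simp_all add: mhom_def)
  show F: "factor M [u, v] f \<in> Arr M" "src M (factor M [u, v] f) = [trg M u, trg M v]"
    "trg M (factor M [u, v] f) = trg M f"
    using * by (simp_all add: mhom_def)
  assume as: "Els as (src M u)" "Els bs (src M v)"
  have "composable M (factor M [u, v] f) [u, v]" using F u by (simp add: composable_def)
  then show "ap (factor M [u, v] f) [ap u as, ap v bs] = ap f (as @ bs)"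
    using ap_cmp[of "factor M [u, v] f" "[u, v]" "[as, bs]"] as *(2) by simp
qed

lemma commutative_monoidI:
  assumes v [simp]: "preuniversal M v" "trg M v = carr X"
    and m: "mul0 X \<in> mhom M [] (carr X)" "mul2 X \<in> mhom M [carr X, carr X] (carr X)"
    and zero_left: "\<And>as. Els as (src M v) \<Longrightarrow> plus X (zero X) (ap v as) = ap v as"
    and assoc: "\<And>as bs cs. Els as (src M v) \<Longrightarrow> Els bs (src M v) \<Longrightarrow> Els cs (src M v) \<Longrightarrow>
      plus X (plus X (ap v as) (ap v bs)) (ap v cs) = plus X (ap v as) (plus X (ap v bs) (ap v cs))"
    and commute: "\<And>as bs. Els as (src M v) \<Longrightarrow> Els bs (src M v) \<Longrightarrow>
      plus X (ap v as) (ap v bs) = plus X (ap v bs) (ap v as)"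
  shows "mon X"
proof -
  have [simp]: "carr X \<in> Obj M" using trg_Obj[of v] by simp
  have [simp]: "mul0 X \<in> Arr M" "src M (mul0 X) = []" "trg M (mul0 X) = carr X"
    "mul2 X \<in> Arr M" "src M (mul2 X) = [carr X, carr X]" "trg M (mul2 X) = carr X"
    using m by (simp_all add: mhom_def)
  have zero [simp]: "zero X \<in> El (carr X)" by (simp add: zero_def)
  have comm: "act M (transpose 0 1) (mul2 X) = mul2 X"
  proof (rule arrow_eqI_universal[OF representable, of "[v, v]"])
    fix ass assume "list_all2 (\<lambda>v as. Els as (src M v)) [v, v] ass"
    then show "ap (act M (transpose 0 1) (mul2 X)) (map2 ap [v, v] ass) = ap (mul2 X) (map2 ap [v, v] ass)"
      using commute by (auto simp: list_all2_Cons1 plus_def)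
  qed (simp_all add: mhom_def)
  have zl: "cmp M (mul2 X) [mul0 X, idn M (carr X)] = idn M (carr X)"
  proof (rule arrow_eqI_universal[OF representable, of "[v]"])
    fix ass assume "list_all2 (\<lambda>v as. Els as (src M v)) [v] ass"
    then show "ap (cmp M (mul2 X) [mul0 X, idn M (carr X)]) (map2 ap [v] ass) = ap (idn M (carr X)) (map2 ap [v] ass)"
      using zero_left by (auto simp: list_all2_Cons1 plus_def zero_def)
  qed (simp_all add: mhom_def)
  have zr: "cmp M (mul2 X) [idn M (carr X), mul0 X] = idn M (carr X)"
  proof (rule arrow_eqI)
    fix as assume "Els as [carr X]"
    then obtain a where a [simp]: "as = [a]" "a \<in> El (carr X)" by (auto simp: list_all2_Cons2)
    have "ap (act M (transpose 0 1) (mul2 X)) [a, zero X] = ap (cmp M (mul2 X) [mul0 X, idn M (carr X)]) [a]"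
      by (simp add: zero_def)
    then show "ap (cmp M (mul2 X) [idn M (carr X), mul0 X]) as = ap (idn M (carr X)) as"
      by (simp only: zl comm) (simp add: zero_def)
  qed (simp_all add: mhom_def)
  have "cmp M (mul2 X) [mul2 X, idn M (carr X)] = cmp M (mul2 X) [idn M (carr X), mul2 X]"
  proof (rule arrow_eqI_universal[OF representable, of "[v, v, v]"])
    fix ass assume "list_all2 (\<lambda>v as. Els as (src M v)) [v, v, v] ass"
    then show "ap (cmp M (mul2 X) [mul2 X, idn M (carr X)]) (map2 ap [v, v, v] ass)
        = ap (cmp M (mul2 X) [idn M (carr X), mul2 X]) (map2 ap [v, v, v] ass)"
      using assoc by (auto simp: list_all2_Cons1 plus_def)
  qed (simp_all add: mhom_def)
  then show ?thesis using m comm zl zr by (simp add: commutative_monoid_def)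
qed

lemma cmon_morphismI:
  assumes [simp]: "mon X" "mon Y" and v [simp]: "preuniversal M v" "trg M v = carr X"
    and f [simp]: "f \<in> Arr M" "src M f = [carr X]" "trg M f = carr Y"
    and zero: "ap f [zero X] = zero Y"
    and plus: "\<And>as bs. Els as (src M v) \<Longrightarrow> Els bs (src M v) \<Longrightarrow>
      ap f [plus X (ap v as) (ap v bs)] = plus Y (ap f [ap v as]) (ap f [ap v bs])"
  shows "cmon_morphism M X Y f"
proof -
  have "cmp M f [mul0 X] = mul0 Y"
    by (rule arrow_eqI[of _ "[]" "carr Y"]) (use zero in \<open>simp_all add: mhom_def zero_def\<close>)
  moreover have "cmp M f [mul2 X] = cmp M (mul2 Y) [f, f]"
  proof (rule arrow_eqI_universal[OF representable, of "[v, v]"])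
    fix ass assume "list_all2 (\<lambda>v as. Els as (src M v)) [v, v] ass"
    then show "ap (cmp M f [mul2 X]) (map2 ap [v, v] ass) = ap (cmp M (mul2 Y) [f, f]) (map2 ap [v, v] ass)"
      using plus by (auto simp: list_all2_Cons1 plus_def)
  qed (simp_all add: mhom_def)
  ultimately show ?thesis by (simp add: cmon_morphism_def mhom_def)
qed

lemma unary_eqI_universal:
  assumes "preuniversal M v" and f: "f \<in> Arr M" "src M f = [trg M v]"
    and g: "g \<in> Arr M" "src M g = [trg M v]" "trg M f = trg M g"
    and eq: "\<And>as. Els as (src M v) \<Longrightarrow> ap f [ap v as] = ap g [ap v as]"
  shows "f = g"
proof (rule arrow_eqI_universal[OF representable, of "[v]"])
  fix ass assume "list_all2 (\<lambda>v as. Els as (src M v)) [v] ass"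
  then show "ap f (map2 ap [v] ass) = ap g (map2 ap [v] ass)"
    using eq by (auto simp: list_all2_Cons1)
qed (use assms in \<open>simp_all add: mhom_def\<close>)

end


section \<open>The tensor product of commutative monoids\<close>

context representable_tensor
begin

lemma t_simps [simp]:
  assumes "A \<in> Obj M" "B \<in> Obj M"
  shows "preuniversal M (t A B)" "t A B \<in> Arr M" "src M (t A B) = [A, B]" "trg M (t A B) \<in> Obj M"
  using assms t_universal src_t trg_Obj by simp_all

lemma e_simps [simp]: "preuniversal M e" "e \<in> Arr M" "src M e = []" "trg M e \<in> Obj M"
  using e_universal src_e trg_Obj by simp_all

definition pair :: "('o, 'a) cmon \<Rightarrow> ('o, 'a) cmon \<Rightarrow>
    (nat list \<times> 'a) set \<Rightarrow> (nat list \<times> 'a) set \<Rightarrow> (nat list \<times> 'a) set" where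
  "pair X Y a b = ap (t (carr X) (carr Y)) [a, b]"

abbreviation T where "T \<equiv> tensor_cmon M t"
abbreviation I where "I \<equiv> unit_cmon M e"

lemma carr_T: "carr (T X Y) = trg M (t (carr X) (carr Y))"
  by (simp add: tensor_cmon_def Let_def)

lemma carr_I: "carr I = trg M e"
  by (simp add: unit_cmon_def)

context
  fixes X Y assumes XY [simp]: "mon X" "mon Y"
begin

lemma pair_El [simp]: "a \<in> El (carr X) \<Longrightarrow> b \<in> El (carr Y) \<Longrightarrow> pair X Y a b \<in> El (carr (T X Y))"
  by (simp add: pair_def carr_T)

lemma mul0_T: "mul0 (T X Y) = cmp M (t (carr X) (carr Y)) [mul0 X, mul0 Y]"
  by (simp add: tensor_cmon_def Let_def)

lemma zero_T: "zero (T X Y) = pair X Y (zero X) (zero Y)"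
  by (simp add: zero_def pair_def mul0_T)

lemma mul2_T: "mul2 (T X Y) = factor M [t (carr X) (carr Y), t (carr X) (carr Y)]
    (act M (transpose (Suc 0) 2) (cmp M (t (carr X) (carr Y)) [mul2 X, mul2 Y]))"
  by (simp add: tensor_cmon_def Let_def)

lemma plus_T:
  assumes [simp]: "a \<in> El (carr X)" "b \<in> El (carr Y)" "c \<in> El (carr X)" "d \<in> El (carr Y)"
  shows "plus (T X Y) (pair X Y a b) (pair X Y c d) = pair X Y (plus X a c) (plus Y b d)"
proof -
  let ?u = "t (carr X) (carr Y)"
  let ?w = "cmp M ?u [mul2 X, mul2 Y]"
  have "plus (T X Y) (pair X Y a b) (pair X Y c d) = ap (act M (transpose (Suc 0) 2) ?w) [a, b, c, d]"
    unfolding plus_def pair_def mul2_T by (subst factor2(4)) simp_all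
  also have "\<dots> = ap ?w [a, c, b, d]" by simp
  also have "\<dots> = pair X Y (plus X a c) (plus Y b d)" by (simp add: pair_def plus_def)
  finally show ?thesis .
qed

lemma mon_T [simp]: "mon (T X Y)"
proof (rule commutative_monoidI[of "t (carr X) (carr Y)"])
  let ?u = "t (carr X) (carr Y)"
  show "plus (T X Y) (zero (T X Y)) (ap ?u as) = ap ?u as"
    if "Els as (src M ?u)" for as
    using that by (auto simp: list_all2_Cons2 zero_T plus_T simp flip: pair_def)
  show "plus (T X Y) (ap ?u as) (ap ?u bs)
      = plus (T X Y) (ap ?u bs) (ap ?u as)"
    if "Els as (src M ?u)" "Els bs (src M ?u)" for as bs
    using that plus_commute[of X] plus_commute[of Y]
    by (auto simp: list_all2_Cons2 plus_T simp flip: pair_def)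
  show "plus (T X Y) (plus (T X Y) (ap ?u as) (ap ?u bs)) (ap ?u cs)
      = plus (T X Y) (ap ?u as) (plus (T X Y) (ap ?u bs) (ap ?u cs))"
    if "Els as (src M ?u)" "Els bs (src M ?u)" "Els cs (src M ?u)"
    for as bs cs
    using that by (auto simp: list_all2_Cons2 plus_T plus_assoc simp flip: pair_def)
qed (simp_all add: mul0_T mul2_T carr_T mhom_def)

lemma T_morphismI:
  assumes "mon Z" "f \<in> Arr M" "src M f = [carr (T X Y)]" "trg M f = carr Z"
    and "ap f [pair X Y (zero X) (zero Y)] = zero Z"
    and "\<And>a b c d. a \<in> El (carr X) \<Longrightarrow> b \<in> El (carr Y) \<Longrightarrow> c \<in> El (carr X) \<Longrightarrow> d \<in> El (carr Y) \<Longrightarrow>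
      ap f [pair X Y (plus X a c) (plus Y b d)] = plus Z (ap f [pair X Y a b]) (ap f [pair X Y c d])"
  shows "cmon_morphism M (T X Y) Z f"
  by (rule cmon_morphismI[of _ _ "t (carr X) (carr Y)"])
    (use assms in \<open>auto simp: list_all2_Cons2 plus_T zero_T carr_T simp flip: pair_def\<close>)

lemma T_eqI:
  assumes "f \<in> Arr M" "g \<in> Arr M" "src M f = [carr (T X Y)]" "src M g = [carr (T X Y)]" "trg M f = trg M g"
    and "\<And>a b. a \<in> El (carr X) \<Longrightarrow> b \<in> El (carr Y) \<Longrightarrow> ap f [pair X Y a b] = ap g [pair X Y a b]"
  shows "f = g"
  by (rule unary_eqI_universal[of "t (carr X) (carr Y)"])
    (use assms in \<open>auto simp: list_all2_Cons2 carr_T simp flip: pair_def\<close>)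

end

lemma mul_I: "mul0 I = e" "mul2 I = factor M [e, e] e"
  by (simp_all add: unit_cmon_def)

lemma zero_I: "zero I = ap e []"
  by (simp add: zero_def mul_I)

lemma plus_I: "plus I (ap e []) (ap e []) = ap e []"
  unfolding plus_def mul_I by (subst factor2(4)) simp_all

lemma mon_I [simp]: "mon I"
  by (rule commutative_monoidI[of e]) (auto simp: mul_I carr_I zero_I plus_I mhom_def)

abbreviation C where "C \<equiv> cMon_monoidal M t e"

lemma C_simps:
  "Ob C = {X. mon X}" "Ide C X = (X, idn M (carr X), X)"
  "(Y, g, Z) \<cdot>\<^bsub>C\<^esub> (X, f, Y') = (X, cmp M g [f], Z)"
  "X \<otimes>\<^bsub>C\<^esub> Y = T X Y" "Unit C = I"
  "(X, f, X') \<odot>\<^bsub>C\<^esub> (Y, g, Y') =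
    (T X Y, tensor_arrow M t (carr X) (carr X') (carr Y) (carr Y') f g, T X' Y')"
  "Assoc C X Y Z = (T (T X Y) Z, tensor_assoc M t (carr X) (carr Y) (carr Z), T X (T Y Z))"
  "Lunit C X = (T I X, tensor_lunit M t e (carr X), X)"
  "Runit C X = (T X I, tensor_runit M t e (carr X), X)"
  "Braid C X Y = (T X Y, tensor_braid M t (carr X) (carr Y), T Y X)"
  by (simp_all add: cMon_monoidal_def Let_def cat.extend_def moncat.fields_def cMon_def)

lemma hom_C: "F \<in> hom C X Y \<longleftrightarrow> (\<exists>f. F = (X, f, Y) \<and> mon X \<and> mon Y \<and> cmon_morphism M X Y f)"
  by (cases F) (auto simp: hom_def cMon_monoidal_def Let_def cat.extend_def moncat.fields_def cMon_def)

lemma hom_CE: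
  assumes "F \<in> hom C X Y"
  obtains f where "F = (X, f, Y)" "mon X" "mon Y" "cmon_morphism M X Y f"
  using assms unfolding hom_C by blast

lemma unary_eqI:
  assumes "f \<in> Arr M" "g \<in> Arr M" "src M f = [A]" "src M g = [A]" "trg M f = trg M g"
    and "\<And>a. a \<in> El A \<Longrightarrow> ap f [a] = ap g [a]"
  shows "f = g"
  by (rule arrow_eqI[of _ "[A]" "trg M g"]) (use assms in \<open>auto simp: list_all2_Cons2 mhom_def\<close>)

lemma morI:
  assumes [simp]: "mon X" "mon Y" "f \<in> Arr M" "src M f = [carr X]" "trg M f = carr Y"
    and "ap f [zero X] = zero Y"
    and "\<And>a b. a \<in> El (carr X) \<Longrightarrow> b \<in> El (carr X) \<Longrightarrow> ap f [plus X a b] = plus Y (ap f [a]) (ap f [b])"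
  shows "cmon_morphism M X Y f"
  by (rule cmon_morphismI[of _ _ "idn M (carr X)"]) (use assms in \<open>auto simp: list_all2_Cons2\<close>)

lemma category_C: "category C"
proof
  show "Dom C F \<in> Ob C" "Cod C F \<in> Ob C" if "F \<in> Ar C" for F
  proof -
    have "F \<in> hom C (Dom C F) (Cod C F)" using that by (simp add: hom_def)
    then show "Dom C F \<in> Ob C" "Cod C F \<in> Ob C" by (auto simp: hom_C C_simps)
  qed
  show "Ide C X \<in> hom C X X" if "X \<in> Ob C" for X
    using that by (auto simp: hom_C C_simps intro!: morI)
  fix F X Y assume "F \<in> hom C X Y"
  then obtain f where f: "F = (X, f, Y)" "mon X" "mon Y" "cmon_morphism M X Y f"
    by (rule hom_CE)
  note [simp] = f(1-3) cmon_morphism_simps[OF f(4,2,3)]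
  show "F \<cdot>\<^bsub>C\<^esub> Ide C X = F" "Ide C Y \<cdot>\<^bsub>C\<^esub> F = F"
    by (auto simp: C_simps intro!: unary_eqI[of _ _ "carr X"])
  fix G Z assume "G \<in> hom C Y Z"
  then obtain g where g: "G = (Y, g, Z)" "mon Y" "mon Z" "cmon_morphism M Y Z g"
    by (rule hom_CE)
  note [simp] = g(1,3) cmon_morphism_simps[OF g(4,2,3)]
  show "G \<cdot>\<^bsub>C\<^esub> F \<in> hom C X Z"
    by (auto simp: hom_C C_simps intro!: morI)
  fix H W assume "H \<in> hom C Z W"
  then obtain h where h: "H = (Z, h, W)" "mon Z" "mon W" "cmon_morphism M Z W h"
    by (rule hom_CE)
  note [simp] = h(1,3) cmon_morphism_simps[OF h(4,2,3)]
  show "H \<cdot>\<^bsub>C\<^esub> G \<cdot>\<^bsub>C\<^esub> F = H \<cdot>\<^bsub>C\<^esub> (G \<cdot>\<^bsub>C\<^esub> F)"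
    by (auto simp: C_simps intro!: unary_eqI[of _ _ "carr X"])
qed

lemma I_initial: "initial_object C I"
proof -
  have "\<exists>!F. F \<in> hom C I X" if [simp]: "mon X" for X
  proof (rule ex1I)
    let ?f = "factor M [e] (mul0 X)"
    have f [simp]: "?f \<in> Arr M" "src M ?f = [carr I]" "trg M ?f = carr X" "ap ?f [ap e []] = zero X"
      using factor1(4)[of e "mul0 X" "[]"] by (simp_all add: carr_I zero_def)
    have "cmon_morphism M I X ?f"
      by (rule cmon_morphismI[of _ _ e]) (simp_all add: zero_I plus_I carr_I[symmetric])
    then show "(I, ?f, X) \<in> hom C I X" by (simp add: hom_C)
    fix F assume "F \<in> hom C I X"
    then obtain g where g: "F = (I, g, X)" "mon I" "mon X" "cmon_morphism M I X g"
      by (rule hom_CE)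
    have "ap g [ap e []] = zero X" using cmon_morphism_zero[OF g(4,2,3)] by (simp add: zero_I)
    with g(1) cmon_morphism_mhom[OF g(4,2,3)] show "F = (I, ?f, X)"
      by (auto simp flip: carr_I intro!: unary_eqI_universal[of e])
  qed
  then show ?thesis by (simp add: initial_object_def C_simps)
qed

definition inl where "inl X Y = cmp M (t (carr X) (carr Y)) [idn M (carr X), mul0 Y]"
definition inr where "inr X Y = cmp M (t (carr X) (carr Y)) [mul0 X, idn M (carr Y)]"

lemma inl_simps [simp]:
  assumes [simp]: "mon X" "mon Y"
  shows "inl X Y \<in> Arr M" "src M (inl X Y) = [carr X]" "trg M (inl X Y) = carr (T X Y)"
    "a \<in> El (carr X) \<Longrightarrow> ap (inl X Y) [a] = pair X Y a (zero Y)"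
  by (simp_all add: inl_def carr_T pair_def zero_def)

lemma inr_simps [simp]:
  assumes [simp]: "mon X" "mon Y"
  shows "inr X Y \<in> Arr M" "src M (inr X Y) = [carr Y]" "trg M (inr X Y) = carr (T X Y)"
    "b \<in> El (carr Y) \<Longrightarrow> ap (inr X Y) [b] = pair X Y (zero X) b"
  by (simp_all add: inr_def carr_T pair_def zero_def)

lemma sum_C:
  assumes [simp]: "mon X" "mon Y"
  shows "binary_sum C X Y (T X Y) (X, inl X Y, T X Y) (Y, inr X Y, T X Y)"
proof -
  have "(X, inl X Y, T X Y) \<in> hom C X (T X Y)" "(Y, inr X Y, T X Y) \<in> hom C Y (T X Y)"
    by (auto simp: hom_C zero_T plus_T intro!: morI)
  moreover have "\<exists>!H. H \<in> hom C (T X Y) Z \<and> H \<cdot>\<^bsub>C\<^esub> (X, inl X Y, T X Y) = F \<and> H \<cdot>\<^bsub>C\<^esub> (Y, inr X Y, T X Y) = G"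
    if FG: "F \<in> hom C X Z" "G \<in> hom C Y Z" for F G Z
  proof -
    obtain f where f: "F = (X, f, Z)" "mon X" "mon Z" "cmon_morphism M X Z f"
      by (rule hom_CE[OF FG(1)])
    note [simp] = f(1,3) cmon_morphism_simps[OF f(4,2,3)]
    obtain g where g: "G = (Y, g, Z)" "mon Y" "mon Z" "cmon_morphism M Y Z g"
      by (rule hom_CE[OF FG(2)])
    note [simp] = g(1) cmon_morphism_simps[OF g(4,2,3)]
    let ?h = "factor M [t (carr X) (carr Y)] (cmp M (mul2 Z) [f, g])"
    have h [simp]: "?h \<in> Arr M" "src M ?h = [carr (T X Y)]" "trg M ?h = carr Z"
      "\<And>a b. a \<in> El (carr X) \<Longrightarrow> b \<in> El (carr Y) \<Longrightarrow> ap ?h [pair X Y a b] = plus Z (ap f [a]) (ap g [b])"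
      by (simp_all add: carr_T pair_def plus_def)
    have medial: "plus Z (plus Z a c) (plus Z b d) = plus Z (plus Z a b) (plus Z c d)"
      if [simp]: "a \<in> El (carr Z)" "b \<in> El (carr Z)" "c \<in> El (carr Z)" "d \<in> El (carr Z)" for a b c d
    proof -
      have "plus Z (plus Z a c) (plus Z b d) = plus Z a (plus Z (plus Z c b) d)"
        by (simp add: plus_assoc)
      also have "\<dots> = plus Z (plus Z a b) (plus Z c d)"
        by (simp add: plus_commute[of Z c b] plus_assoc)
      finally show ?thesis .
    qed
    show ?thesis
    proof (rule ex1I)
      have "cmon_morphism M (T X Y) Z ?h"
        by (rule T_morphismI) (simp_all add: medial del: factor1)
      moreover have "cmp M ?h [inl X Y] = f"
        by (rule unary_eqI[of _ _ "carr X"]) (simp_all del: factor1)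
      moreover have "cmp M ?h [inr X Y] = g"
        by (rule unary_eqI[of _ _ "carr Y"]) (simp_all del: factor1)
      ultimately show "(T X Y, ?h, Z) \<in> hom C (T X Y) Z \<and> (T X Y, ?h, Z) \<cdot>\<^bsub>C\<^esub> (X, inl X Y, T X Y) = F \<and> (T X Y, ?h, Z) \<cdot>\<^bsub>C\<^esub> (Y, inr X Y, T X Y) = G"
        by (simp add: hom_C C_simps)
    next
      fix H assume H: "H \<in> hom C (T X Y) Z \<and> H \<cdot>\<^bsub>C\<^esub> (X, inl X Y, T X Y) = F \<and> H \<cdot>\<^bsub>C\<^esub> (Y, inr X Y, T X Y) = G"
      then obtain k where k: "H = (T X Y, k, Z)" "mon (T X Y)" "mon Z" "cmon_morphism M (T X Y) Z k"
        by (blast elim: hom_CE)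
      note [simp] = k(1) cmon_morphism_simps[OF k(4,2,3)]
      have eqs: "cmp M k [inl X Y] = f" "cmp M k [inr X Y] = g"
        using H by (simp_all add: C_simps)
      have "k = ?h"
      proof (rule T_eqI[of X Y])
        fix a b assume [simp]: "a \<in> El (carr X)" "b \<in> El (carr Y)"
        have "ap (cmp M k [inl X Y]) [a] = ap f [a]" "ap (cmp M k [inr X Y]) [b] = ap g [b]" by (simp_all only: eqs)
        then have "ap k [pair X Y a (zero Y)] = ap f [a]" "ap k [pair X Y (zero X) b] = ap g [b]"
          by simp_all
        moreover have "pair X Y a b = plus (T X Y) (pair X Y a (zero Y)) (pair X Y (zero X) b)"
          by (simp add: plus_T)
        ultimately have "ap k [pair X Y a b] = plus Z (ap f [a]) (ap g [b])" by simp
        then show "ap k [pair X Y a b] = ap ?h [pair X Y a b]" by (simp del: factor1)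
      qed (simp_all del: factor1)
      then show "H = (T X Y, ?h, Z)" by simp
    qed
  qed
  ultimately show ?thesis by (simp add: binary_sum_def)
qed

lemma tensor_arrow_simps:
  assumes f: "mon X" "mon X'" "cmon_morphism M X X' f" and g: "mon Y" "mon Y'" "cmon_morphism M Y Y' g"
  defines "h \<equiv> tensor_arrow M t (carr X) (carr X') (carr Y) (carr Y') f g"
  shows "h \<in> Arr M" "src M h = [carr (T X Y)]" "trg M h = carr (T X' Y')"
    "a \<in> El (carr X) \<Longrightarrow> b \<in> El (carr Y) \<Longrightarrow> ap h [pair X Y a b] = pair X' Y' (ap f [a]) (ap g [b])"
proof -
  note [simp] = f(1,2) g(1,2) cmon_morphism_simps[OF f(3,1,2)] cmon_morphism_simps[OF g(3,1,2)]
  show "h \<in> Arr M" "src M h = [carr (T X Y)]" "trg M h = carr (T X' Y')"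
    "a \<in> El (carr X) \<Longrightarrow> b \<in> El (carr Y) \<Longrightarrow> ap h [pair X Y a b] = pair X' Y' (ap f [a]) (ap g [b])"
    by (simp_all add: h_def tensor_arrow_def carr_T pair_def)
qed

lemma tensor_arrow_morphism:
  assumes f: "mon X" "mon X'" "cmon_morphism M X X' f" and g: "mon Y" "mon Y'" "cmon_morphism M Y Y' g"
  shows "cmon_morphism M (T X Y) (T X' Y') (tensor_arrow M t (carr X) (carr X') (carr Y) (carr Y') f g)"
proof -
  note [simp] = f(1,2) g(1,2) cmon_morphism_simps[OF f(3,1,2)] cmon_morphism_simps[OF g(3,1,2)]
    tensor_arrow_simps[OF assms]
  show ?thesis by (rule T_morphismI) (simp_all add: zero_T plus_T)
qed

lemma tensor_assoc:
  assumes [simp]: "mon X" "mon Y" "mon Z"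
  defines "h \<equiv> tensor_assoc M t (carr X) (carr Y) (carr Z)"
  shows tensor_assoc_simps: "h \<in> Arr M" "src M h = [carr (T (T X Y) Z)]" "trg M h = carr (T X (T Y Z))"
      "a \<in> El (carr X) \<Longrightarrow> b \<in> El (carr Y) \<Longrightarrow> c \<in> El (carr Z) \<Longrightarrow>
        ap h [pair (T X Y) Z (pair X Y a b) c] = pair X (T Y Z) a (pair Y Z b c)"
    and tensor_assoc_morphism: "cmon_morphism M (T (T X Y) Z) (T X (T Y Z)) h"
proof -
  define v where "v = cmp M (t (trg M (t (carr X) (carr Y))) (carr Z)) [t (carr X) (carr Y), idn M (carr Z)]"
  define w where "w = cmp M (t (carr X) (trg M (t (carr Y) (carr Z)))) [idn M (carr X), t (carr Y) (carr Z)]"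
  have v [simp]: "preuniversal M v" "v \<in> Arr M" "src M v = [carr X, carr Y, carr Z]" "trg M v = carr (T (T X Y) Z)"
    "\<And>a b c. a \<in> El (carr X) \<Longrightarrow> b \<in> El (carr Y) \<Longrightarrow> c \<in> El (carr Z) \<Longrightarrow>
      ap v [a, b, c] = pair (T X Y) Z (pair X Y a b) c"
    by (simp_all add: v_def carr_T pair_def)
  have w [simp]: "w \<in> Arr M" "src M w = [carr X, carr Y, carr Z]" "trg M w = carr (T X (T Y Z))"
    "\<And>a b c. a \<in> El (carr X) \<Longrightarrow> b \<in> El (carr Y) \<Longrightarrow> c \<in> El (carr Z) \<Longrightarrow>
      ap w [a, b, c] = pair X (T Y Z) a (pair Y Z b c)"
    by (simp_all add: w_def carr_T pair_def)
  have h: "h = factor M [v] w"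
    by (simp add: h_def tensor_assoc_def v_def w_def)
  show [simp]: "h \<in> Arr M" "src M h = [carr (T (T X Y) Z)]" "trg M h = carr (T X (T Y Z))"
    by (simp_all add: h)
  show act [simp]: "ap h [pair (T X Y) Z (pair X Y a b) c] = pair X (T Y Z) a (pair Y Z b c)"
    if "a \<in> El (carr X)" "b \<in> El (carr Y)" "c \<in> El (carr Z)" for a b c
    using that factor1(4)[of v w "[a, b, c]"] by (simp add: h)
  show "cmon_morphism M (T (T X Y) Z) (T X (T Y Z)) h"
    by (rule cmon_morphismI[of _ _ v]) (auto simp: list_all2_Cons2 zero_T plus_T)
qed

lemma tensor_lunit:
  assumes [simp]: "mon X"
  defines "h \<equiv> tensor_lunit M t e (carr X)"
  shows tensor_lunit_simps: "h \<in> Arr M" "src M h = [carr (T I X)]" "trg M h = carr X"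
      "a \<in> El (carr X) \<Longrightarrow> ap h [pair I X (zero I) a] = a"
    and tensor_lunit_morphism: "cmon_morphism M (T I X) X h"
proof -
  define v where "v = cmp M (t (trg M e) (carr X)) [e, idn M (carr X)]"
  have v [simp]: "preuniversal M v" "v \<in> Arr M" "src M v = [carr X]" "trg M v = carr (T I X)"
    "\<And>a. a \<in> El (carr X) \<Longrightarrow> ap v [a] = pair I X (zero I) a"
    by (simp_all add: v_def carr_T carr_I pair_def zero_I)
  have h: "h = factor M [v] (idn M (carr X))"
    by (simp add: h_def tensor_lunit_def v_def)
  show [simp]: "h \<in> Arr M" "src M h = [carr (T I X)]" "trg M h = carr X"
    by (simp_all add: h)
  show act [simp]: "ap h [pair I X (zero I) a] = a" if "a \<in> El (carr X)" for a
    using that factor1(4)[of v "idn M (carr X)" "[a]"] by (simp add: h)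
  show "cmon_morphism M (T I X) X h"
    by (rule cmon_morphismI[of _ _ v]) (auto simp: list_all2_Cons2 zero_T plus_T)
qed

lemma tensor_runit:
  assumes [simp]: "mon X"
  defines "h \<equiv> tensor_runit M t e (carr X)"
  shows tensor_runit_simps: "h \<in> Arr M" "src M h = [carr (T X I)]" "trg M h = carr X"
      "a \<in> El (carr X) \<Longrightarrow> ap h [pair X I a (zero I)] = a"
    and tensor_runit_morphism: "cmon_morphism M (T X I) X h"
proof -
  define v where "v = cmp M (t (carr X) (trg M e)) [idn M (carr X), e]"
  have v [simp]: "preuniversal M v" "v \<in> Arr M" "src M v = [carr X]" "trg M v = carr (T X I)"
    "\<And>a. a \<in> El (carr X) \<Longrightarrow> ap v [a] = pair X I a (zero I)"
    by (simp_all add: v_def carr_T carr_I pair_def zero_I)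
  have h: "h = factor M [v] (idn M (carr X))"
    by (simp add: h_def tensor_runit_def v_def)
  show [simp]: "h \<in> Arr M" "src M h = [carr (T X I)]" "trg M h = carr X"
    by (simp_all add: h)
  show act [simp]: "ap h [pair X I a (zero I)] = a" if "a \<in> El (carr X)" for a
    using that factor1(4)[of v "idn M (carr X)" "[a]"] by (simp add: h)
  show "cmon_morphism M (T X I) X h"
    by (rule cmon_morphismI[of _ _ v]) (auto simp: list_all2_Cons2 zero_T plus_T)
qed

lemmas coherence_simps [simp] = tensor_assoc_simps tensor_lunit_simps tensor_runit_simps

lemma tensor_braid_simps [simp]:
  assumes [simp]: "mon X" "mon Y"
  defines "h \<equiv> tensor_braid M t (carr X) (carr Y)"
  shows "h \<in> Arr M" "src M h = [carr (T X Y)]" "trg M h = carr (T Y X)"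
    "a \<in> El (carr X) \<Longrightarrow> b \<in> El (carr Y) \<Longrightarrow> ap h [pair X Y a b] = pair Y X b a"
  by (simp_all add: h_def tensor_braid_def carr_T pair_def)

lemma tensor_braid_morphism:
  assumes [simp]: "mon X" "mon Y"
  shows "cmon_morphism M (T X Y) (T Y X) (tensor_braid M t (carr X) (carr Y))"
  by (rule T_morphismI) (simp_all add: zero_T plus_T)

lemma tensor_sums: "monoidal_sums C (\<lambda>X Y. (X, inl X Y, T X Y)) (\<lambda>X Y. (Y, inr X Y, T X Y))"
proof (intro monoidal_sums.intro monoidal_sums_axioms.intro category_C)
  show "initial_object C (Unit C)" by (simp add: C_simps I_initial)
  fix F G X X' Y Y' assume "F \<in> hom C X X'" "G \<in> hom C Y Y'"
  then obtain f g where f: "F = (X, f, X')" "mon X" "mon X'" "cmon_morphism M X X' f"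
    and g: "G = (Y, g, Y')" "mon Y" "mon Y'" "cmon_morphism M Y Y' g"
    by (blast elim: hom_CE)
  note [simp] = f(1-3) g(1-3) tensor_arrow_simps[OF f(2-4) g(2-4)] cmon_morphism_simps[OF f(4,2,3)]
    cmon_morphism_simps[OF g(4,2,3)]
  show "F \<odot>\<^bsub>C\<^esub> G \<in> hom C (X \<otimes>\<^bsub>C\<^esub> Y) (X' \<otimes>\<^bsub>C\<^esub> Y')"
    using tensor_arrow_morphism[OF f(2-4) g(2-4)] by (simp add: C_simps hom_C)
  show "F \<odot>\<^bsub>C\<^esub> G \<cdot>\<^bsub>C\<^esub> (X, inl X Y, T X Y) = (X', inl X' Y', T X' Y') \<cdot>\<^bsub>C\<^esub> F"
    by (auto simp: C_simps intro!: unary_eqI[of _ _ "carr X"])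
  show "F \<odot>\<^bsub>C\<^esub> G \<cdot>\<^bsub>C\<^esub> (Y, inr X Y, T X Y) = (Y', inr X' Y', T X' Y') \<cdot>\<^bsub>C\<^esub> G"
    by (auto simp: C_simps intro!: unary_eqI[of _ _ "carr Y"])
next
  fix X assume "X \<in> Ob C"
  then have [simp]: "mon X" by (simp add: C_simps)
  show "Lunit C X \<in> hom C (Unit C \<otimes>\<^bsub>C\<^esub> X) X" "Runit C X \<in> hom C (X \<otimes>\<^bsub>C\<^esub> Unit C) X"
    by (simp_all add: C_simps hom_C tensor_lunit_morphism tensor_runit_morphism)
  show "Lunit C X \<cdot>\<^bsub>C\<^esub> (X, inr (Unit C) X, T (Unit C) X) = Ide C X"
    "Runit C X \<cdot>\<^bsub>C\<^esub> (X, inl X (Unit C), T X (Unit C)) = Ide C X"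
    by (auto simp: C_simps intro!: unary_eqI[of _ _ "carr X"])
  fix Y assume "Y \<in> Ob C"
  then have [simp]: "mon Y" by (simp add: C_simps)
  show "X \<otimes>\<^bsub>C\<^esub> Y \<in> Ob C" by (simp add: C_simps)
  show "binary_sum C X Y (X \<otimes>\<^bsub>C\<^esub> Y) (X, inl X Y, T X Y) (Y, inr X Y, T X Y)"
    by (simp add: C_simps sum_C)
  show "Braid C X Y \<in> hom C (X \<otimes>\<^bsub>C\<^esub> Y) (Y \<otimes>\<^bsub>C\<^esub> X)"
    by (simp add: C_simps hom_C tensor_braid_morphism)
  show "Braid C X Y \<cdot>\<^bsub>C\<^esub> (X, inl X Y, T X Y) = (X, inr Y X, T Y X)"
    by (auto simp: C_simps intro!: unary_eqI[of _ _ "carr X"])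
  show "Braid C X Y \<cdot>\<^bsub>C\<^esub> (Y, inr X Y, T X Y) = (Y, inl Y X, T Y X)"
    by (auto simp: C_simps intro!: unary_eqI[of _ _ "carr Y"])
  fix Z assume "Z \<in> Ob C"
  then have [simp]: "mon Z" by (simp add: C_simps)
  show "Assoc C X Y Z \<in> hom C (X \<otimes>\<^bsub>C\<^esub> Y \<otimes>\<^bsub>C\<^esub> Z) (X \<otimes>\<^bsub>C\<^esub> (Y \<otimes>\<^bsub>C\<^esub> Z))"
    by (simp add: C_simps hom_C tensor_assoc_morphism)
  show "Assoc C X Y Z \<cdot>\<^bsub>C\<^esub> ((X \<otimes>\<^bsub>C\<^esub> Y, inl (X \<otimes>\<^bsub>C\<^esub> Y) Z, T (X \<otimes>\<^bsub>C\<^esub> Y) Z) \<cdot>\<^bsub>C\<^esub> (X, inl X Y, T X Y)) =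
      (X, inl X (Y \<otimes>\<^bsub>C\<^esub> Z), T X (Y \<otimes>\<^bsub>C\<^esub> Z))"
    by (auto simp: C_simps zero_T intro!: unary_eqI[of _ _ "carr X"])
  show "Assoc C X Y Z \<cdot>\<^bsub>C\<^esub> ((X \<otimes>\<^bsub>C\<^esub> Y, inl (X \<otimes>\<^bsub>C\<^esub> Y) Z, T (X \<otimes>\<^bsub>C\<^esub> Y) Z) \<cdot>\<^bsub>C\<^esub> (Y, inr X Y, T X Y)) =
      (Y \<otimes>\<^bsub>C\<^esub> Z, inr X (Y \<otimes>\<^bsub>C\<^esub> Z), T X (Y \<otimes>\<^bsub>C\<^esub> Z)) \<cdot>\<^bsub>C\<^esub> (Y, inl Y Z, T Y Z)"
    by (auto simp: C_simps zero_T intro!: unary_eqI[of _ _ "carr Y"])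
  show "Assoc C X Y Z \<cdot>\<^bsub>C\<^esub> (Z, inr (X \<otimes>\<^bsub>C\<^esub> Y) Z, T (X \<otimes>\<^bsub>C\<^esub> Y) Z) =
      (Y \<otimes>\<^bsub>C\<^esub> Z, inr X (Y \<otimes>\<^bsub>C\<^esub> Z), T X (Y \<otimes>\<^bsub>C\<^esub> Z)) \<cdot>\<^bsub>C\<^esub> (Z, inr Y Z, T Y Z)"
    by (auto simp: C_simps zero_T intro!: unary_eqI[of _ _ "carr Z"])
qed

end

theorem corollary3p21:
  fixes M :: "('o, 'a) multicat"
    and t :: "'o \<Rightarrow> 'o \<Rightarrow> 'a"
    and e :: "'a"
  assumes "symmetric_multicategory M"
    and "representable M"
    and "tensor_choice M t e"
  shows "cocartesian_monoidal_category (cMon_monoidal M t e)"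
proof -
  interpret representable_tensor M t e
    using assms by (simp add: representable_tensor_def representable_tensor_axioms_def)
  show ?thesis by (rule monoidal_sums.cocartesian[OF tensor_sums])
qed

end
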